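(* Suppose that $Q$ is a group with subgroups $L$, $M$, $P$ such that the following conditions hold: (i) $M$ and $P$ are normal in $Q$. (ii) $LM\subseteq P$. (iii) $M$ is a Mal'cev complete nilpotent group of finite Hirsch length. (iv) Either $L=1$ and $P/M$ is nilpotent, or $LM=P$ and $L$ is nilpotent. Then $Q$ has a subgroup $Q_0$ such that $L\subseteq Q_0$, $P\cap Q_0$ is nilpotent, and $Q_0M=Q$. If moreover $Q/M$ and $L$ are finitely generated, then $Q_0$ can be taken to be finitely generated too.
   Context: A nilpotent group $M$ is Mal'cev complete if it coincides with its Mal'cev completion, i.e. for every integer $n\ge1$ the map $x\mapsto x^n$ is a bijection $M\to M$ (equivalently $M$ is torsion-free and divisible). The Hirsch length of a nilpotent group is finite if it has a finite series $1=G_0\lhd G_1\lhd\dots\lhd G_n$ ending in the group with each factor cyclic or locally finite, and then equals the number of infinite cyclic factors in any such series; otherwise it is infinite. *)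

theory Defs
  imports "HOL-Algebra.Algebra" "HOL-Library.Extended_Nat"
begin

text \<open>As usual in HOL-Algebra, a subgroup \<open>H\<close> of \<open>G\<close> is regarded as a group in its own right
  via \<open>G\<lparr>carrier := H\<rparr>\<close>.\<close>

primrec lower_central :: "('a, 'b) monoid_scheme \<Rightarrow> nat \<Rightarrow> 'a set" where
  "lower_central G 0 = carrier G"
| "lower_central G (Suc n) =
     generate G (\<Union>x \<in> lower_central G n. \<Union>y \<in> carrier G.
       {x \<otimes>\<^bsub>G\<^esub> y \<otimes>\<^bsub>G\<^esub> inv\<^bsub>G\<^esub> x \<otimes>\<^bsub>G\<^esub> inv\<^bsub>G\<^esub> y})"

definition nilpotent :: "('a, 'b) monoid_scheme \<Rightarrow> bool" where
  "nilpotent G \<longleftrightarrow> (\<exists>n. lower_central G n = {\<one>\<^bsub>G\<^esub>})"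

definition finitely_generated :: "('a, 'b) monoid_scheme \<Rightarrow> bool" where
  "finitely_generated G \<longleftrightarrow> (\<exists>S. finite S \<and> S \<subseteq> carrier G \<and> generate G S = carrier G)"

definition locally_finite :: "('a, 'b) monoid_scheme \<Rightarrow> bool" where
  "locally_finite G \<longleftrightarrow> (\<forall>S. finite S \<and> S \<subseteq> carrier G \<longrightarrow> finite (generate G S))"

definition malcev_complete :: "('a, 'b) monoid_scheme \<Rightarrow> bool" where
  "malcev_complete G \<longleftrightarrow>
     (\<forall>n::nat. n \<ge> 1 \<longrightarrow> bij_betw (\<lambda>x. x [^]\<^bsub>G\<^esub> n) (carrier G) (carrier G))"

definition series_factor :: "('a, 'b) monoid_scheme \<Rightarrow> (nat \<Rightarrow> 'a set) \<Rightarrow> nat \<Rightarrow> 'a set monoid" where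
  "series_factor G S i = G\<lparr>carrier := S (Suc i)\<rparr> Mod S i"

text \<open>Each term is normal in the next one, but not necessarily in \<open>G\<close>. Only the values
  \<open>S 0, \<dots>, S n\<close> matter.\<close>

definition hirsch_series :: "('a, 'b) monoid_scheme \<Rightarrow> nat \<Rightarrow> (nat \<Rightarrow> 'a set) \<Rightarrow> bool" where
  "hirsch_series G n S \<longleftrightarrow>
     S 0 = {\<one>\<^bsub>G\<^esub>} \<and> S n = carrier G \<and>
     (\<forall>i\<le>n. subgroup (S i) G) \<and>
     (\<forall>i<n. S i \<lhd> G\<lparr>carrier := S (Suc i)\<rparr> \<and>
            (cyclic_group (series_factor G S i) \<or> locally_finite (series_factor G S i)))"

definition num_infinite_cyclic :: "('a, 'b) monoid_scheme \<Rightarrow> nat \<Rightarrow> (nat \<Rightarrow> 'a set) \<Rightarrow> nat" where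
  "num_infinite_cyclic G n S =
     card {i. i < n \<and> cyclic_group (series_factor G S i) \<and>
                      infinite (carrier (series_factor G S i))}"

text \<open>The description operator relies on the classical fact that the number of infinite cyclic
  factors does not depend on the series. Whether the Hirsch length is finite does not depend on
  that fact.\<close>

definition hirsch_length :: "('a, 'b) monoid_scheme \<Rightarrow> enat" where
  "hirsch_length G =
     (if \<exists>n S. hirsch_series G n S
      then enat (THE h. \<exists>n S. hirsch_series G n S \<and> num_infinite_cyclic G n S = h)
      else \<infinity>)"

end

theory Submission
  imports Defs
begin

text \<open>
  Let \<open>1 = Z\<^sub>0 < Z\<^sub>1 < \<dots> < Z\<^sub>n = M\<close> be the upper central series of \<open>M\<close>. Every \<open>Z\<^sub>i\<close> is normal in \<open>Q\<close>,
  and because \<open>M\<close> is torsion-free and divisible of finite Hirsch length, every factor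
  \<open>Z\<^sub>i\<^sub>+\<^sub>1/Z\<^sub>i\<close> is a finite-dimensional rational vector space; \<open>M\<close> acts trivially on it. The subgroup
  \<open>Q\<^sub>0\<close> is obtained by descending this series. The invariant is a subgroup \<open>R\<close> with
  \<open>L \<subseteq> R\<close>, \<open>Z\<^sub>i \<subseteq> R\<close> and \<open>RM = Q\<close> such that \<open>P \<inter> R\<close> is nilpotent modulo \<open>Z\<^sub>i\<close>; it starts with
  \<open>R = Q\<close> at \<open>Z\<^sub>n = M\<close>, and at \<open>Z\<^sub>0 = 1\<close> it is the claim.

  For one step (\<open>nilpotent_supplement_step\<close>) let \<open>A/Z\<^sub>i\<close> be the part of \<open>Z\<^sub>i\<^sub>+\<^sub>1/Z\<^sub>i\<close> on which \<open>P\<close> acts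
  unipotently. It is harmless, since iterated commutators with \<open>P\<close> take \<open>A\<close> into \<open>Z\<^sub>i\<close>. On
  \<open>V = Z\<^sub>i\<^sub>+\<^sub>1/A\<close> the group \<open>P\<close> has no nonzero fixed vector, and then \<open>R/A\<close> splits over \<open>V\<close>; a complement
  is the next \<open>R\<close>. Modulo \<open>A\<close>, its intersection with \<open>P\<close> is isomorphic to the nilpotent group
  \<open>(P \<inter> R)/Z\<^sub>i\<^sub>+\<^sub>1\<close>, so this intersection is nilpotent modulo \<open>Z\<^sub>i\<close>.

  If \<open>LM = P\<close>, then \<open>L\<close> is nilpotent and has no fixed vector
  on \<open>V\<close> either, so \<open>L\<close> meets \<open>V\<close> trivially. Working modulo \<open>A\<close>, both \<open>L\<close> and the intersection of the
  chosen complement with \<open>LV\<close> are complements of \<open>V\<close> in \<open>LV\<close>. Complements in \<open>LV\<close> are conjugate under \<open>V\<close>,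
  so a conjugate of the chosen complement contains \<open>L\<close>.

  The splitting is the vanishing of the cohomology of a nilpotent group acting without
  fixed points on a finite-dimensional space, but it has an elementary proof. Call it unique
  splitting when complements exist, form one conjugacy class under \<open>V\<close>, and \<open>V\<close> has no fixed points.

  \<^item> If \<open>1 - z\<close> is bijective on \<open>V\<close>, the preimage of the centraliser of \<open>z\<close> modulo \<open>V\<close> splits uniquely;
    the complement is the centraliser of \<open>z\<close> (\<open>splits_uniquely_centraliser\<close>).
  \<^item> Unique splitting passes from \<open>S\<close> to any group containing \<open>S\<close> as a normal subgroup, by the
    Frattini argument: the normaliser of a complement in \<open>S\<close> is a complement in the larger group
    (\<open>splits_uniquely_normal_overgroup\<close>). As subgroups of nilpotent groups are subnormal and
    \<open>P \<inter> R\<close> is normal in \<open>R\<close>, this leads from the centraliser to \<open>P \<inter> R\<close> and then to \<open>R\<close>.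
  \<^item> Unique splitting for a submodule and for its quotient gives it for the module
    (\<open>splits_uniquely_trans\<close>). This reduces the general case to the first item, by an induction on
    the dimension (\<open>splits_uniquely_of_fixed_point_free\<close>).

  Linear algebra enters only through a rank function that is strictly monotone on isolated
  subgroups of \<open>M\<close>; it counts the infinite cyclic factors of a fixed series that are met by the
  subgroup (\<open>rank_function_of_finite_hirsch_length\<close>).

  If \<open>Q/M\<close> and \<open>L\<close> are finitely generated, the subgroup generated by generators of \<open>L\<close> together with
  representatives in \<open>Q\<^sub>0\<close> of generators of \<open>Q/M\<close> still has all required properties.
\<close>

context group
begin

section \<open>Commutators and conjugation\<close>

lemma inv_mult_cancel: "\<lbrakk>x \<in> carrier G; y \<in> carrier G\<rbrakk> \<Longrightarrow> inv x \<otimes> (x \<otimes> y) = y"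
  by (simp flip: m_assoc)

lemma mult_inv_cancel: "\<lbrakk>x \<in> carrier G; y \<in> carrier G\<rbrakk> \<Longrightarrow> x \<otimes> (inv x \<otimes> y) = y"
  by (simp flip: m_assoc)

text \<open>Reassociating to the right and cancelling adjacent inverse letters decides equality of words in
  a free group.\<close>

lemmas word_simps = m_assoc inv_mult_group inv_mult_cancel mult_inv_cancel

definition commutator :: "'a \<Rightarrow> 'a \<Rightarrow> 'a"
  where "commutator x y = x \<otimes> y \<otimes> inv x \<otimes> inv y"

text \<open>Only an inclusion is asked for; when \<open>H\<close> is a subgroup, the inverses of its elements turn it
  into the equality of \<open>normalises_iff_conjugate\<close>.\<close>

definition normalises :: "'a set \<Rightarrow> 'a set \<Rightarrow> bool"
  where "normalises H A \<longleftrightarrow> (\<forall>h\<in>H. \<forall>a\<in>A. h \<otimes> a \<otimes> inv h \<in> A)"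

definition conjugate :: "'a \<Rightarrow> 'a set \<Rightarrow> 'a set"
  where "conjugate g T = (\<lambda>t. g \<otimes> t \<otimes> inv g) ` T"

lemma commutator_closed [simp]:
  "\<lbrakk>x \<in> carrier G; y \<in> carrier G\<rbrakk> \<Longrightarrow> commutator x y \<in> carrier G"
  by (simp add: commutator_def)

lemma commutator_in_subgroup:
  "\<lbrakk>subgroup H G; x \<in> H; y \<in> H\<rbrakk> \<Longrightarrow> commutator x y \<in> H"
  unfolding commutator_def by (simp add: subgroup.m_closed subgroup.m_inv_closed)

lemma commutator_mult_left:
  "\<lbrakk>x \<in> carrier G; y \<in> carrier G; z \<in> carrier G\<rbrakk> \<Longrightarrow>
     commutator (x \<otimes> y) z = (x \<otimes> commutator y z \<otimes> inv x) \<otimes> commutator x z"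
  unfolding commutator_def by (simp add: word_simps)

lemma commutator_mult_right:
  "\<lbrakk>x \<in> carrier G; y \<in> carrier G; z \<in> carrier G\<rbrakk> \<Longrightarrow>
     commutator x (y \<otimes> z) = commutator x y \<otimes> (y \<otimes> commutator x z \<otimes> inv y)"
  unfolding commutator_def by (simp add: word_simps)

lemma commutator_inv_left:
  "\<lbrakk>x \<in> carrier G; y \<in> carrier G\<rbrakk> \<Longrightarrow>
     commutator (inv x) y = inv x \<otimes> inv (commutator x y) \<otimes> x"
  unfolding commutator_def by (simp add: word_simps)

lemma commutator_swap:
  "\<lbrakk>x \<in> carrier G; y \<in> carrier G\<rbrakk> \<Longrightarrow> commutator x y = inv (commutator y x)"
  unfolding commutator_def by (simp add: word_simps)

lemma conj_commutator:
  "\<lbrakk>g \<in> carrier G; x \<in> carrier G; y \<in> carrier G\<rbrakk> \<Longrightarrow>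
     g \<otimes> commutator x y \<otimes> inv g = commutator (g \<otimes> x \<otimes> inv g) (g \<otimes> y \<otimes> inv g)"
  unfolding commutator_def by (simp add: word_simps)

lemma conj_conv_commutator:
  "\<lbrakk>x \<in> carrier G; y \<in> carrier G\<rbrakk> \<Longrightarrow> x \<otimes> y \<otimes> inv x = commutator x y \<otimes> y"
  unfolding commutator_def by (simp add: word_simps)

lemma commutator_eq_one_iff:
  assumes "x \<in> carrier G" "y \<in> carrier G"
  shows "commutator x y = \<one> \<longleftrightarrow> x \<otimes> y = y \<otimes> x"
proof
  assume "commutator x y = \<one>"
  then have "commutator x y \<otimes> (y \<otimes> x) = y \<otimes> x" using assms by simp
  then show "x \<otimes> y = y \<otimes> x" using assms by (simp add: commutator_def word_simps)
next
  assume *: "x \<otimes> y = y \<otimes> x"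
  show "commutator x y = \<one>" using assms by (simp add: commutator_def * word_simps)
qed

lemma pow_conj:
  assumes "x \<in> carrier G" "y \<in> carrier G"
  shows "(y \<otimes> x \<otimes> inv y) [^] (n::nat) = y \<otimes> x [^] n \<otimes> inv y"
  by (induction n) (use assms in \<open>simp_all add: word_simps\<close>)

text \<open>Here \<open>x\<close> is the product of \<open>c = [x, y]\<close> and \<open>y x y\<inverse>\<close>; as \<open>c\<close> commutes with \<open>x\<close>, these factors
  commute, and so \<open>x\<^sup>n\<close> is the product of \<open>c\<^sup>n\<close> and \<open>y x\<^sup>n y\<inverse>\<close>.\<close>

lemma commutator_pow_left:
  assumes x: "x \<in> carrier G" and y: "y \<in> carrier G"
    and c: "commutator x y \<otimes> x = x \<otimes> commutator x y"
  shows "commutator (x [^] (n::nat)) y = commutator x y [^] n"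
proof -
  let ?c = "commutator x y" and ?z = "y \<otimes> x \<otimes> inv y"
  have x_eq: "x = ?c \<otimes> ?z" using x y by (simp add: commutator_def word_simps)
  have "?z = inv ?c \<otimes> x" using x y by (simp add: commutator_def word_simps)
  moreover have "?c \<otimes> (inv ?c \<otimes> x) = (inv ?c \<otimes> x) \<otimes> ?c"
    using x y c by (simp add: m_assoc flip: c) (simp add: word_simps)
  ultimately have "?c \<otimes> ?z = ?z \<otimes> ?c" by simp
  then have "(?c \<otimes> ?z) [^] n = ?c [^] n \<otimes> ?z [^] n"
    using x y by (intro pow_mult_distrib) auto
  then have "x [^] n = ?c [^] n \<otimes> (y \<otimes> x [^] n \<otimes> inv y)"
    using x_eq pow_conj[OF x y] by metis
  then have "x [^] n \<otimes> y \<otimes> inv (x [^] n) \<otimes> inv y =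
      (?c [^] n \<otimes> (y \<otimes> x [^] n \<otimes> inv y)) \<otimes> y \<otimes> inv (x [^] n) \<otimes> inv y" by simp
  then show ?thesis using x y by (simp add: commutator_def[of "x [^] n"] word_simps)
qed

lemma normalisesD: "\<lbrakk>normalises H A; h \<in> H; a \<in> A\<rbrakk> \<Longrightarrow> h \<otimes> a \<otimes> inv h \<in> A"
  by (simp add: normalises_def)

lemma normalises_inv:
  assumes "normalises H A" "subgroup H G" "h \<in> H" "a \<in> A"
  shows "inv h \<otimes> a \<otimes> h \<in> A"
  using normalisesD[OF assms(1) subgroup.m_inv_closed[OF assms(2,3)] assms(4)] assms
  by (simp add: subgroup.mem_carrier)

lemma normalises_mono: "\<lbrakk>normalises H A; T \<subseteq> H\<rbrakk> \<Longrightarrow> normalises T A"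
  by (auto simp: normalises_def)

lemma normalises_commutator_right:
  assumes "subgroup A G" "normalises H A" "h \<in> H" "H \<subseteq> carrier G" "a \<in> A"
  shows "commutator h a \<in> A"
  unfolding commutator_def
  using assms by (meson normalisesD subgroup.m_closed subgroup.m_inv_closed)

lemma normalises_commutator_left:
  assumes "subgroup A G" "normalises H A" "h \<in> H" "H \<subseteq> carrier G" "a \<in> A"
  shows "commutator a h \<in> A"
proof -
  have "commutator a h = inv (commutator h a)"
    using assms by (intro commutator_swap) (auto simp: subgroup.mem_carrier)
  then show ?thesis using normalises_commutator_right[OF assms] assms(1)
    by (simp add: subgroup.m_inv_closed)
qed

lemma mem_conjugate_iff:
  assumes "g \<in> carrier G" "T \<subseteq> carrier G"
  shows "x \<in> conjugate g T \<longleftrightarrow> x \<in> carrier G \<and> inv g \<otimes> x \<otimes> g \<in> T"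
proof
  assume "x \<in> conjugate g T"
  then obtain t where t: "t \<in> T" "x = g \<otimes> t \<otimes> inv g" by (auto simp: conjugate_def)
  then have "t \<in> carrier G" using assms by auto
  then show "x \<in> carrier G \<and> inv g \<otimes> x \<otimes> g \<in> T" using t assms by (simp add: word_simps)
next
  assume x: "x \<in> carrier G \<and> inv g \<otimes> x \<otimes> g \<in> T"
  then have "x = g \<otimes> (inv g \<otimes> x \<otimes> g) \<otimes> inv g" using assms by (simp add: word_simps)
  then show "x \<in> conjugate g T" using x unfolding conjugate_def by blast
qed

lemma conjugate_closed: "\<lbrakk>g \<in> carrier G; T \<subseteq> carrier G\<rbrakk> \<Longrightarrow> conjugate g T \<subseteq> carrier G"
  by (auto simp: conjugate_def)

lemma conjugate_mult:
  assumes "g \<in> carrier G" "h \<in> carrier G" "T \<subseteq> carrier G"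
  shows "conjugate (g \<otimes> h) T = conjugate g (conjugate h T)"
  unfolding conjugate_def image_image
  using assms by (intro image_cong) (auto simp: word_simps subset_iff)

lemma conjugate_one: "T \<subseteq> carrier G \<Longrightarrow> conjugate \<one> T = T"
  unfolding conjugate_def by (force simp: subset_iff)

lemma conjugate_inv_cancel:
  assumes "g \<in> carrier G" "T \<subseteq> carrier G"
  shows "conjugate (inv g) (conjugate g T) = T" "conjugate g (conjugate (inv g) T) = T"
  using assms by (simp_all add: conjugate_one flip: conjugate_mult)

lemma subgroup_conjugate:
  assumes "g \<in> carrier G" "subgroup T G"
  shows "subgroup (conjugate g T) G"
proof (rule subgroupI)
  have T: "T \<subseteq> carrier G" using assms(2) by (rule subgroup.subset)
  show "conjugate g T \<subseteq> carrier G" using assms T by (simp add: conjugate_closed)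
  show "conjugate g T \<noteq> {}"
    using subgroup.one_closed[OF assms(2)] by (auto simp: conjugate_def)
  fix a assume "a \<in> conjugate g T"
  then obtain s where s: "s \<in> T" "a = g \<otimes> s \<otimes> inv g" by (auto simp: conjugate_def)
  moreover have "inv a = g \<otimes> inv s \<otimes> inv g" using s T assms by (auto simp: word_simps subset_iff)
  ultimately show "inv a \<in> conjugate g T"
    using subgroup.m_inv_closed[OF assms(2)] by (auto simp: conjugate_def)
  fix b assume "b \<in> conjugate g T"
  then obtain t where t: "t \<in> T" "b = g \<otimes> t \<otimes> inv g" by (auto simp: conjugate_def)
  have "a \<otimes> b = g \<otimes> (s \<otimes> t) \<otimes> inv g" using s t T assms by (auto simp: word_simps subset_iff)
  then show "a \<otimes> b \<in> conjugate g T"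
    using s t subgroup.m_closed[OF assms(2)] by (auto simp: conjugate_def)
qed

lemma normalises_iff_conjugate:
  assumes H: "subgroup H G" and A: "A \<subseteq> carrier G"
  shows "normalises H A \<longleftrightarrow> (\<forall>h\<in>H. conjugate h A = A)"
proof
  assume n: "normalises H A"
  show "\<forall>h\<in>H. conjugate h A = A"
  proof (intro ballI equalityI subsetI)
    fix h x assume h: "h \<in> H"
    { assume "x \<in> conjugate h A" then show "x \<in> A"
        using n h by (auto simp: conjugate_def normalises_def) }
    assume "x \<in> A" then show "x \<in> conjugate h A"
      using normalises_inv[OF n H h] h H A
      by (subst mem_conjugate_iff) (auto simp: subgroup.mem_carrier)
  qed
qed (auto simp: conjugate_def normalises_def)

lemma subgroup_normaliser_in:
  assumes R: "subgroup R G" and T: "T \<subseteq> carrier G"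
  shows "subgroup {r \<in> R. conjugate r T = T} G"
proof (rule subgroupI)
  have R': "R \<subseteq> carrier G" using R by (rule subgroup.subset)
  show "{r \<in> R. conjugate r T = T} \<subseteq> carrier G" using R' by auto
  show "{r \<in> R. conjugate r T = T} \<noteq> {}"
    using subgroup.one_closed[OF R] conjugate_one[OF T] by auto
  fix a assume a: "a \<in> {r \<in> R. conjugate r T = T}"
  then show "inv a \<in> {r \<in> R. conjugate r T = T}"
    using conjugate_inv_cancel(1)[of a T] R' T subgroup.m_inv_closed[OF R] by auto
  fix b assume "b \<in> {r \<in> R. conjugate r T = T}"
  with a show "a \<otimes> b \<in> {r \<in> R. conjugate r T = T}"
    using conjugate_mult[of a b T] R' T subgroup.m_closed[OF R] by auto
qed

lemma conjugate_Int:
  assumes "g \<in> carrier G" "S \<subseteq> carrier G" "T \<subseteq> carrier G"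
  shows "conjugate g (S \<inter> T) = conjugate g S \<inter> conjugate g T"
proof -
  have "S \<inter> T \<subseteq> carrier G" using assms by auto
  then show ?thesis using assms by (auto simp: mem_conjugate_iff)
qed

end

section \<open>Computing modulo a normal subgroup\<close>

text \<open>A homomorphism defined on a subgroup \<open>H\<close> only, with kernel \<open>A\<close>. A congruence modulo \<open>A\<close> becomes
  an equation in \<open>K\<close>, where the cancellation rules for group words apply. Sections \<open>V/A\<close> for
  several acting groups \<open>H\<close> are all handled inside one ambient group in this way.\<close>

locale quotient_map = G: group G + K: group K
  for G :: "('a, 'b) monoid_scheme" (structure) and K :: "('c, 'd) monoid_scheme" +
  fixes H A :: "'a set" and p :: "'a \<Rightarrow> 'c"
  assumes H: "subgroup H G"
    and p_closed [simp]: "x \<in> H \<Longrightarrow> p x \<in> carrier K"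
    and p_mult [simp]: "\<lbrakk>x \<in> H; y \<in> H\<rbrakk> \<Longrightarrow> p (x \<otimes> y) = p x \<otimes>\<^bsub>K\<^esub> p y"
    and p_kernel: "x \<in> H \<Longrightarrow> p x = \<one>\<^bsub>K\<^esub> \<longleftrightarrow> x \<in> A"
begin

lemma H_closed [simp]:
  "x \<in> H \<Longrightarrow> x \<in> carrier G" "\<one> \<in> H" "x \<in> H \<Longrightarrow> inv x \<in> H" "\<lbrakk>x \<in> H; y \<in> H\<rbrakk> \<Longrightarrow> x \<otimes> y \<in> H"
  using H by (auto simp: subgroup.mem_carrier subgroup.one_closed subgroup.m_inv_closed
      subgroup.m_closed)

lemma H_pow [simp]: "x \<in> H \<Longrightarrow> x [^] (n::nat) \<in> H"
  by (induction n) auto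

lemma p_one [simp]: "p \<one> = \<one>\<^bsub>K\<^esub>"
  using p_mult[of \<one> \<one>] by (metis G.l_one G.one_closed H_closed(2) K.l_cancel_one p_closed)

lemma p_inv [simp]: "x \<in> H \<Longrightarrow> p (inv x) = inv\<^bsub>K\<^esub> (p x)"
  by (metis G.l_inv H_closed(1,3) K.inv_equality p_closed p_mult p_one)

lemma p_pow [simp]: "x \<in> H \<Longrightarrow> p (x [^] (n::nat)) = p x [^]\<^bsub>K\<^esub> n"
  by (induction n) auto

lemma commutator_H [simp]: "\<lbrakk>x \<in> H; y \<in> H\<rbrakk> \<Longrightarrow> G.commutator x y \<in> H"
  using H by (rule G.commutator_in_subgroup)

lemma p_commutator [simp]:
  "\<lbrakk>x \<in> H; y \<in> H\<rbrakk> \<Longrightarrow> p (G.commutator x y) = K.commutator (p x) (p y)"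
  by (simp add: G.commutator_def K.commutator_def)

lemma commutator_in_iff:
  "\<lbrakk>x \<in> H; y \<in> H\<rbrakk> \<Longrightarrow> G.commutator x y \<in> A \<longleftrightarrow> p x \<otimes>\<^bsub>K\<^esub> p y = p y \<otimes>\<^bsub>K\<^esub> p x"
  by (simp add: K.commutator_eq_one_iff flip: p_kernel)

lemma p_eq_iff: "\<lbrakk>x \<in> H; y \<in> H\<rbrakk> \<Longrightarrow> p x = p y \<longleftrightarrow> x \<otimes> inv y \<in> A"
  by (simp add: flip: p_kernel) (metis K.inv_equality K.inv_inv K.r_inv K.inv_closed p_closed)

end

lemma (in group) quotient_map_FactGroup:
  assumes H: "subgroup H G" and A: "subgroup A G" and AH: "A \<subseteq> H" and n: "normalises H A"
  shows "quotient_map G (G\<lparr>carrier := H\<rparr> Mod A) H A (\<lambda>x. A #> x)"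
proof -
  interpret H: group "G\<lparr>carrier := H\<rparr>" using H by (rule subgroup_imp_group)
  have "subgroup A (G\<lparr>carrier := H\<rparr>)" using subgroup_incl[OF A H AH] .
  then have N: "A \<lhd> G\<lparr>carrier := H\<rparr>"
    unfolding H.normal_inv_iff using n H
    by (auto simp: normalises_def)
  interpret N: normal A "G\<lparr>carrier := H\<rparr>" by (rule N)
  let ?K = "G\<lparr>carrier := H\<rparr> Mod A" and ?p = "\<lambda>x. A #> x"
  have eq: "A #>\<^bsub>G\<lparr>carrier := H\<rparr>\<^esub> x = ?p x" for x by (simp add: r_coset_def)
  have "group ?K" by (rule N.factorgroup_is_group)
  moreover have "\<forall>x\<in>H. ?p x \<in> carrier ?K"
    using eq by (auto simp: FactGroup_def RCOSETS_def)
  moreover have "\<forall>x\<in>H. \<forall>y\<in>H. ?p (x \<otimes> y) = ?p x \<otimes>\<^bsub>?K\<^esub> ?p y"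
    using N.rcos_sum by (simp add: FactGroup_def eq)
  moreover have "\<forall>x\<in>H. ?p x = \<one>\<^bsub>?K\<^esub> \<longleftrightarrow> x \<in> A"
    using coset_join1[OF _ _ A] coset_join2[OF _ A] subgroup.subset[OF H]
    by (auto simp: FactGroup_def subgroup.mem_carrier[OF H])
  ultimately show ?thesis
    using H by (intro quotient_map.intro quotient_map_axioms.intro) (auto simp: is_group)
qed

text \<open>Hiding the quotient behind an existential keeps its elements abstract, so that simplification
  does not unfold products of cosets.\<close>

lemma (in group) obtain_quotient_map:
  assumes "subgroup H G" "subgroup A G" "A \<subseteq> H" "normalises H A"
  obtains K :: "'a set monoid" and p where "quotient_map G K H A p"
  using quotient_map_FactGroup[OF assms] by blast

context group
begin

section \<open>Relative upper central series\<close>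

text \<open>If \<open>N\<close> is normal in \<open>S\<close>, these are the preimages of the upper central series of \<open>S/N\<close>. Working
  with \<open>N\<close> inside one ambient group avoids iterated quotients.\<close>

primrec upper_central :: "'a set \<Rightarrow> 'a set \<Rightarrow> nat \<Rightarrow> 'a set" where
  "upper_central S N 0 = N"
| "upper_central S N (Suc i) = {x \<in> S. \<forall>y\<in>S. commutator x y \<in> upper_central S N i}"

definition nilpotent_mod :: "'a set \<Rightarrow> 'a set \<Rightarrow> bool"
  where "nilpotent_mod S N \<longleftrightarrow> (\<exists>n. S \<subseteq> upper_central S N n)"

lemma upper_central_subset: "N \<subseteq> S \<Longrightarrow> upper_central S N i \<subseteq> S"
  by (cases i) auto

lemma normalises_upper_central:
  assumes R: "subgroup R G" and S: "S \<subseteq> carrier G" "normalises R S" and N: "normalises R N"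
  shows "normalises R (upper_central S N i)"
proof (induction i)
  case (Suc i)
  show ?case unfolding normalises_def
  proof (intro ballI)
    fix g x assume g: "g \<in> R" and x: "x \<in> upper_central S N (Suc i)"
    then have xS: "x \<in> S" by simp
    have "commutator (g \<otimes> x \<otimes> inv g) y \<in> upper_central S N i" if y: "y \<in> S" for y
    proof -
      have y': "inv g \<otimes> y \<otimes> g \<in> S" using normalises_inv[OF S(2) R g y] .
      have c: "g \<in> carrier G" "x \<in> carrier G" "y \<in> carrier G"
        using g xS y S R by (auto simp: subgroup.mem_carrier)
      have "commutator (g \<otimes> x \<otimes> inv g) y =
          g \<otimes> commutator x (inv g \<otimes> y \<otimes> g) \<otimes> inv g"
        using c by (simp add: conj_commutator) (simp add: word_simps)
      then show ?thesis using Suc g x y' by (simp add: normalises_def)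
    qed
    then show "g \<otimes> x \<otimes> inv g \<in> upper_central S N (Suc i)"
      using g xS S(2) by (simp add: normalises_def)
  qed
qed (use N in simp)

lemma normalises_self: "subgroup S G \<Longrightarrow> normalises S S"
  unfolding normalises_def by (simp add: subgroup.m_closed subgroup.m_inv_closed)

text \<open>Centralisers modulo \<open>A\<close> in this form comprise the terms of upper central series, the kernel of
  \<open>1 - z\<close> on a section, and the fixed points of a group acting on it.\<close>

lemma subgroup_commutators_in:
  assumes V: "subgroup V G" and A: "subgroup A G" and n: "normalises V A"
    and E: "E \<subseteq> carrier G"
  shows "subgroup {v \<in> V. \<forall>x\<in>E. commutator v x \<in> A} G"
proof (rule subgroupI)
  have V': "V \<subseteq> carrier G" using V by (rule subgroup.subset)
  show "{v \<in> V. \<forall>x\<in>E. commutator v x \<in> A} \<subseteq> carrier G" using V' by auto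
  have "commutator \<one> x = \<one>" if "x \<in> E" for x
    using that E by (auto simp: commutator_def)
  then show "{v \<in> V. \<forall>x\<in>E. commutator v x \<in> A} \<noteq> {}"
    using subgroup.one_closed[OF V] subgroup.one_closed[OF A] by (auto intro!: exI[of _ \<one>])
  fix a assume a: "a \<in> {v \<in> V. \<forall>x\<in>E. commutator v x \<in> A}"
  have "commutator (inv a) x \<in> A" if x: "x \<in> E" for x
  proof -
    have "inv (commutator a x) \<in> A" using a x A by (simp add: subgroup.m_inv_closed)
    then show ?thesis
      using a x E V' normalises_inv[OF n V, of a] by (auto simp: commutator_inv_left subset_iff)
  qed
  then show "inv a \<in> {v \<in> V. \<forall>x\<in>E. commutator v x \<in> A}"
    using a V by (simp add: subgroup.m_inv_closed)
  fix b assume b: "b \<in> {v \<in> V. \<forall>x\<in>E. commutator v x \<in> A}"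
  have "commutator (a \<otimes> b) x \<in> A" if x: "x \<in> E" for x
    using a b x E V' A by (auto simp: commutator_mult_left subset_iff
        intro!: subgroup.m_closed[OF A] normalisesD[OF n])
  then show "a \<otimes> b \<in> {v \<in> V. \<forall>x\<in>E. commutator v x \<in> A}"
    using a b V by (simp add: subgroup.m_closed)
qed

lemma subgroup_upper_central:
  assumes "subgroup S G" "subgroup N G" "normalises S N"
  shows "subgroup (upper_central S N i) G"
proof (induction i)
  case (Suc i)
  have "normalises S (upper_central S N i)"
    using assms by (intro normalises_upper_central normalises_self) (auto simp: subgroup.subset)
  from subgroup_commutators_in[OF assms(1) Suc this subgroup.subset[OF assms(1)]]
  show ?case by simp
qed (use assms in simp)

lemma upper_central_Suc:
  assumes "subgroup S G" "subgroup N G" "N \<subseteq> S" "normalises S N"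
  shows "upper_central S N i \<subseteq> upper_central S N (Suc i)"
proof
  fix x assume x: "x \<in> upper_central S N i"
  have S: "S \<subseteq> carrier G" using assms(1) by (rule subgroup.subset)
  have "normalises S (upper_central S N i)"
    using assms S by (intro normalises_upper_central normalises_self)
  then have "commutator x y \<in> upper_central S N i" if "y \<in> S" for y
    using normalises_commutator_left[OF subgroup_upper_central[OF assms(1,2,4)] _ that S x] by simp
  then show "x \<in> upper_central S N (Suc i)"
    using x upper_central_subset[OF assms(3)] by auto
qed

lemma upper_central_mono:
  assumes "subgroup S G" "subgroup N G" "N \<subseteq> S" "normalises S N" "i \<le> j"
  shows "upper_central S N i \<subseteq> upper_central S N j"
  using upper_central_Suc[OF assms(1-4)] assms(5) by (rule lift_Suc_mono_le)

lemma upper_central_restrict: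
  assumes "subgroup T G" "T \<subseteq> S"
  shows "T \<inter> upper_central S N i \<subseteq> upper_central T (T \<inter> N) i"
proof (induction i)
  case (Suc i)
  show ?case
  proof
    fix x assume x: "x \<in> T \<inter> upper_central S N (Suc i)"
    have "commutator x y \<in> T \<inter> upper_central S N i" if "y \<in> T" for y
      using x that assms commutator_in_subgroup[OF assms(1)] by auto
    then show "x \<in> upper_central T (T \<inter> N) (Suc i)" using Suc x by auto
  qed
qed simp

lemma nilpotent_mod_restrict:
  assumes "subgroup T G" "T \<subseteq> S" "nilpotent_mod S N"
  shows "nilpotent_mod T (T \<inter> N)"
  using assms upper_central_restrict[OF assms(1,2)] unfolding nilpotent_mod_def by blast

lemma upper_central_trans:
  assumes "B \<subseteq> upper_central S A k"
  shows "upper_central S B i \<subseteq> upper_central S A (i + k)"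
  using assms by (induction i) auto

text \<open>An extension of a hypercentral section by a nilpotent quotient is nilpotent.\<close>

lemma nilpotent_mod_trans:
  "\<lbrakk>nilpotent_mod S B; B \<subseteq> upper_central S A k\<rbrakk> \<Longrightarrow> nilpotent_mod S A"
  unfolding nilpotent_mod_def using upper_central_trans by blast

text \<open>The lower central series descends at least as fast as the upper one, read from the top.\<close>

lemma nilpotent_mod_imp_nilpotent:
  assumes S: "subgroup S G" and nil: "nilpotent_mod S {\<one>}"
  shows "nilpotent (G\<lparr>carrier := S\<rparr>)"
proof -
  let ?S = "G\<lparr>carrier := S\<rparr>"
  interpret S: group ?S using S by (rule subgroup_imp_group)
  have triv: "subgroup {\<one>} G" "normalises S {\<one>}"
    using S by (auto simp: normalises_def triv_subgroup subgroup.mem_carrier)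
  have one: "\<one> \<in> S" using S by (rule subgroup.one_closed)
  obtain n where n: "S \<subseteq> upper_central S {\<one>} n" using nil by (auto simp: nilpotent_mod_def)
  have "lower_central ?S j \<subseteq> upper_central S {\<one>} (n - j)" if "j \<le> n" for j using that
  proof (induction j)
    case (Suc j)
    let ?U = "upper_central S {\<one>}"
    have n_j: "n - j = Suc (n - Suc j)" using Suc.prems by simp
    have "subgroup (?U (n - Suc j)) ?S"
      using subgroup_incl[OF subgroup_upper_central[OF S triv] S upper_central_subset] one by simp
    moreover have "(\<Union>x\<in>lower_central ?S j. \<Union>y\<in>carrier ?S.
        {x \<otimes>\<^bsub>?S\<^esub> y \<otimes>\<^bsub>?S\<^esub> inv\<^bsub>?S\<^esub> x \<otimes>\<^bsub>?S\<^esub> inv\<^bsub>?S\<^esub> y}) \<subseteq> ?U (n - Suc j)"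
    proof safe
      fix x y assume x: "x \<in> lower_central ?S j" and y: "y \<in> carrier ?S"
      then have "x \<in> ?U (Suc (n - Suc j))" using Suc n_j by auto
      then show "x \<otimes>\<^bsub>?S\<^esub> y \<otimes>\<^bsub>?S\<^esub> inv\<^bsub>?S\<^esub> x \<otimes>\<^bsub>?S\<^esub> inv\<^bsub>?S\<^esub> y \<in> ?U (n - Suc j)"
        using y S by (simp add: commutator_def)
    qed
    ultimately show ?case by (simp add: S.generate_subgroup_incl)
  qed (use n in simp)
  from this[of n] have "lower_central ?S n \<subseteq> {\<one>}" by simp
  moreover have "\<one> \<in> lower_central ?S n"
    using one generate.one[of ?S] by (cases n) simp_all
  ultimately show ?thesis unfolding nilpotent_def by auto
qed

end

context quotient_map
begin

text \<open>If the lower central series of \<open>K\<close> ends after \<open>n\<close> steps, its term \<open>n - i\<close> is contained in term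
  \<open>i\<close> of the upper series; the inclusion is pulled back along \<open>p\<close>.\<close>

lemma nilpotent_mod_of_nilpotent:
  assumes "nilpotent K"
  shows "G.nilpotent_mod H A"
proof -
  obtain n where n: "lower_central K n = {\<one>\<^bsub>K\<^esub>}" using assms by (auto simp: nilpotent_def)
  have "\<lbrakk>x \<in> H; p x \<in> lower_central K (n - i); i \<le> n\<rbrakk> \<Longrightarrow> x \<in> G.upper_central H A i" for i x
  proof (induction i arbitrary: x)
    case 0
    then show ?case using n p_kernel by simp
  next
    case (Suc i)
    have "G.commutator x y \<in> G.upper_central H A i" if y: "y \<in> H" for y
    proof (rule Suc.IH)
      have "n - i = Suc (n - Suc i)" using Suc.prems by simp
      moreover have "p (G.commutator x y) \<in> lower_central K (Suc (n - Suc i))"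
        unfolding p_commutator[OF Suc.prems(1) y] K.commutator_def lower_central.simps
        using Suc.prems(2) p_closed[OF y] by (intro generate.incl) blast
      ultimately show "p (G.commutator x y) \<in> lower_central K (n - i)" by simp
    qed (use Suc.prems y in auto)
    then show ?case using Suc.prems by simp
  qed
  from this[of _ n] have "H \<subseteq> G.upper_central H A n" by auto
  then show ?thesis unfolding G.nilpotent_mod_def by blast
qed

text \<open>Under these conditions \<open>H/A\<close> is a homomorphic image of \<open>T\<close> in which \<open>N\<close> becomes trivial.\<close>

lemma nilpotent_mod_of_supplement:
  assumes T: "subgroup T G" "T \<subseteq> H" and cover: "\<And>h. h \<in> H \<Longrightarrow> \<exists>t\<in>T. p h = p t"
    and N: "N \<subseteq> A" and nil: "G.nilpotent_mod T N"
  shows "G.nilpotent_mod H A"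
proof -
  have "\<lbrakk>t \<in> T; t \<in> G.upper_central T N i; h \<in> H; p h = p t\<rbrakk> \<Longrightarrow> h \<in> G.upper_central H A i" for i t h
  proof (induction i arbitrary: t h)
    case 0
    then have "p t = \<one>\<^bsub>K\<^esub>" using N T(2) p_kernel[of t] by auto
    then show ?case using 0 p_kernel[of h] by simp
  next
    case (Suc i)
    have "G.commutator h y \<in> G.upper_central H A i" if y: "y \<in> H" for y
    proof -
      obtain s where s: "s \<in> T" "p y = p s" using cover y by blast
      have "G.commutator t s \<in> T" "G.commutator t s \<in> G.upper_central T N i"
        using Suc.prems s G.commutator_in_subgroup[OF T(1)] by auto
      moreover have "p (G.commutator h y) = p (G.commutator t s)"
        using Suc.prems s y T(2) by (auto simp: subset_iff)
      ultimately show ?thesis using Suc.IH Suc.prems y by auto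
    qed
    then show ?case using Suc.prems by simp
  qed
  then show ?thesis using nil cover unfolding G.nilpotent_mod_def by blast
qed

end

context group
begin

section \<open>Complements of an abelian section\<close>

text \<open>The section \<open>V/A\<close> is an \<open>H\<close>-module in multiplicative notation; \<open>commutator v h\<close> represents the
  vector \<open>(1 - h) v\<close>.\<close>

definition abelian_section :: "'a set \<Rightarrow> 'a set \<Rightarrow> 'a set \<Rightarrow> bool"
  where "abelian_section H V A \<longleftrightarrow> subgroup H G \<and> subgroup V G \<and> subgroup A G \<and> A \<subseteq> V \<and> V \<subseteq> H \<and>
    normalises H V \<and> normalises H A \<and> (\<forall>u\<in>V. \<forall>v\<in>V. commutator u v \<in> A)"

definition fixed_point_free :: "'a set \<Rightarrow> 'a set \<Rightarrow> 'a set \<Rightarrow> bool"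
  where "fixed_point_free H V A \<longleftrightarrow> (\<forall>v\<in>V. (\<forall>h\<in>H. commutator v h \<in> A) \<longrightarrow> v \<in> A)"

definition complement :: "'a set \<Rightarrow> 'a set \<Rightarrow> 'a set \<Rightarrow> 'a set \<Rightarrow> bool"
  where "complement H V A T \<longleftrightarrow> subgroup T G \<and> A \<subseteq> T \<and> T \<subseteq> H \<and> T \<inter> V \<subseteq> A \<and>
    (\<forall>h\<in>H. \<exists>v\<in>V. \<exists>t\<in>T. h = v \<otimes> t)"

text \<open>The three conditions are what the vanishing of the cohomology of \<open>H/V\<close> with coefficients \<open>V/A\<close>
  gives in degrees 2, 1 and 0. Bundling them matters because the existence of complements in a
  larger group is deduced from all three.\<close>

definition splits_uniquely :: "'a set \<Rightarrow> 'a set \<Rightarrow> 'a set \<Rightarrow> bool"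
  where "splits_uniquely H V A \<longleftrightarrow> (\<exists>T. complement H V A T) \<and>
    (\<forall>T T'. complement H V A T \<longrightarrow> complement H V A T' \<longrightarrow> (\<exists>v\<in>V. conjugate v T' = T)) \<and>
    fixed_point_free H V A"

lemma abelian_sectionD:
  assumes "abelian_section H V A"
  shows "subgroup H G" "subgroup V G" "subgroup A G" "A \<subseteq> V" "V \<subseteq> H"
    "normalises H V" "normalises H A" "\<And>u v. \<lbrakk>u \<in> V; v \<in> V\<rbrakk> \<Longrightarrow> commutator u v \<in> A"
  using assms by (auto simp: abelian_section_def)

lemma abelian_section_subgroup:
  assumes "abelian_section H V A" "subgroup T G" "T \<subseteq> H" "V \<subseteq> T"
  shows "abelian_section T V A"
  using assms by (auto simp: abelian_section_def intro: normalises_mono)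

lemma complementD:
  assumes "complement H V A T"
  shows "subgroup T G" "A \<subseteq> T" "T \<subseteq> H" "T \<inter> V \<subseteq> A"
  using assms by (auto simp: complement_def)

lemma complement_factor:
  assumes "complement H V A T" "h \<in> H"
  obtains v t where "v \<in> V" "t \<in> T" "h = v \<otimes> t"
  using assms unfolding complement_def by blast

lemma complement_subset_eq:
  assumes V: "subgroup V G" and T: "complement H V A T" and T': "complement H V A T'" and sub: "T' \<subseteq> T"
  shows "T' = T"
proof
  have grp: "subgroup T G" "subgroup T' G" using T T' by (auto simp: complement_def)
  show "T \<subseteq> T'"
  proof
    fix t assume t: "t \<in> T"
    then obtain v s where vs: "v \<in> V" "s \<in> T'" "t = v \<otimes> s"
      using complement_factor[OF T'] complementD(3)[OF T] by blast
    then have c: "v \<in> carrier G" "s \<in> carrier G" using grp V by (auto simp: subgroup.mem_carrier)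
    have "v = t \<otimes> inv s" using vs c by (simp add: word_simps)
    moreover have "t \<otimes> inv s \<in> T"
      using t vs sub grp by (auto simp: subgroup.m_closed subgroup.m_inv_closed)
    ultimately have "v \<in> T" by simp
    then have "v \<in> T'" using vs T T' by (auto simp: complement_def)
    then show "t \<in> T'" using vs grp by (simp add: subgroup.m_closed)
  qed
qed (rule sub)

lemma splits_uniquelyI:
  assumes V: "subgroup V G" and N: "complement H V A N"
    and conj: "\<And>U. complement H V A U \<Longrightarrow> \<exists>v\<in>V. conjugate v U = N"
    and fpf: "fixed_point_free H V A"
  shows "splits_uniquely H V A"
proof -
  have "\<exists>v\<in>V. conjugate v T2 = T1"
    if T12: "complement H V A T1" "complement H V A T2" for T1 T2
  proof -
    obtain u v where uv: "u \<in> V" "v \<in> V" "conjugate u T1 = N" "conjugate v T2 = N"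
      using conj T12 by blast
    have c: "T1 \<subseteq> carrier G" "T2 \<subseteq> carrier G" "u \<in> carrier G" "v \<in> carrier G"
      using T12 uv V by (auto simp: complement_def subgroup.subset subgroup.mem_carrier)
    have "conjugate (inv u \<otimes> v) T2 = conjugate (inv u) (conjugate u T1)"
      using uv c by (simp add: conjugate_mult)
    then have "conjugate (inv u \<otimes> v) T2 = T1"
      using c conjugate_inv_cancel(1)[of u T1] by simp
    moreover have "inv u \<otimes> v \<in> V" using uv V by (simp add: subgroup.m_closed subgroup.m_inv_closed)
    ultimately show ?thesis by blast
  qed
  then show ?thesis using N fpf unfolding splits_uniquely_def by blast
qed

lemma complement_Int:
  assumes V: "subgroup V G" and AV: "A \<subseteq> V" and U: "complement R V A U"
    and S: "subgroup S G" "V \<subseteq> S" "S \<subseteq> R"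
  shows "complement S V A (U \<inter> S)"
proof -
  note U' = complementD[OF U]
  have "\<exists>v\<in>V. \<exists>t\<in>U \<inter> S. s = v \<otimes> t" if s: "s \<in> S" for s
  proof -
    obtain v t where vt: "v \<in> V" "t \<in> U" "s = v \<otimes> t"
      using complement_factor[OF U] s S by blast
    then have "t = inv v \<otimes> s"
      using V U'(1) by (auto simp: word_simps subgroup.mem_carrier)
    moreover have "inv v \<otimes> s \<in> S" using vt s S by (auto simp: subgroup.m_closed subgroup.m_inv_closed)
    ultimately have "t \<in> S" by simp
    then show ?thesis using vt by auto
  qed
  then show ?thesis
    using U' S AV subgroups_Inter_pair[OF U'(1) S(1)] by (auto simp: complement_def)
qed

lemma complement_conjugate:
  assumes sec: "abelian_section S V A" and T: "complement S V A T"
    and g: "g \<in> carrier G"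
    and inv: "conjugate g S = S" "conjugate g V = V" "conjugate g A = A"
  shows "complement S V A (conjugate g T)"
proof -
  note D = abelian_sectionD[OF sec]
  have c: "S \<subseteq> carrier G" "V \<subseteq> carrier G" "T \<subseteq> carrier G"
    using D T by (auto simp: complement_def subgroup.subset)
  have mono: "B \<subseteq> C \<Longrightarrow> conjugate g B \<subseteq> conjugate g C" for B C by (auto simp: conjugate_def)
  have "conjugate g T \<inter> V \<subseteq> A"
    using conjugate_Int[OF g c(3,2)] inv mono[of "T \<inter> V" A] T by (auto simp: complement_def)
  moreover have "\<exists>v\<in>V. \<exists>t\<in>conjugate g T. h = v \<otimes> t" if h: "h \<in> S" for h
  proof -
    have "h \<in> conjugate g S" using inv h by simp
    then obtain s where s: "s \<in> S" "h = g \<otimes> s \<otimes> inv g" by (auto simp: conjugate_def)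
    then obtain v t where vt: "v \<in> V" "t \<in> T" "s = v \<otimes> t"
      using complement_factor[OF T] by blast
    have "h = (g \<otimes> v \<otimes> inv g) \<otimes> (g \<otimes> t \<otimes> inv g)"
      using s vt c g by (auto simp: word_simps subset_iff)
    moreover have "g \<otimes> v \<otimes> inv g \<in> V" using inv(2) vt by (auto simp: conjugate_def)
    ultimately show ?thesis using vt by (auto simp: conjugate_def)
  qed
  ultimately show ?thesis
    using T mono[of A T] mono[of T S] inv subgroup_conjugate[OF g]
    by (auto simp: complement_def)
qed

text \<open>A Frattini argument. Let \<open>T\<close> be a complement in \<open>S\<close> and \<open>N\<close> its normaliser in \<open>R\<close>. Conjugacy of
  the complements in \<open>S\<close> under \<open>V\<close> gives \<open>R = VN\<close>. If \<open>v \<in> N \<inter> V\<close> then \<open>[v, T] \<subseteq> T \<inter> V = A\<close>, so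
  \<open>v\<close> represents a fixed point of \<open>S = VT\<close> and lies in \<open>A\<close>; hence \<open>N\<close> is a complement in \<open>R\<close>.
  Any complement in \<open>R\<close> normalises its intersection with \<open>S\<close>, which is conjugate to \<open>T\<close>; so it
  is conjugate to a subgroup of \<open>N\<close>, and thus to \<open>N\<close>.\<close>

lemma splits_uniquely_normal_overgroup:
  assumes sec: "abelian_section R V A" and S: "subgroup S G" "V \<subseteq> S" "S \<subseteq> R"
    and nS: "normalises R S" and split: "splits_uniquely S V A"
  shows "splits_uniquely R V A"
proof -
  note D = abelian_sectionD[OF sec]
  have secS: "abelian_section S V A" using abelian_section_subgroup[OF sec S(1,3,2)] .
  have c: "R \<subseteq> carrier G" "S \<subseteq> carrier G" "V \<subseteq> carrier G" "A \<subseteq> carrier G"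
    using D S by (auto simp: subgroup.subset)
  have inv: "conjugate r S = S" "conjugate r V = V" "conjugate r A = A" if "r \<in> R" for r
    using that nS D(6,7) c by (auto simp: normalises_iff_conjugate[OF D(1)])
  have fpf: "fixed_point_free S V A" using split by (simp add: splits_uniquely_def)
  obtain T where T: "complement S V A T" using split by (auto simp: splits_uniquely_def)
  have T': "subgroup T G" "A \<subseteq> T" "T \<subseteq> S" "T \<inter> V \<subseteq> A" using T by (auto simp: complement_def)
  have cT: "T \<subseteq> carrier G" using T' by (simp add: subgroup.subset)
  define N where "N = {r \<in> R. conjugate r T = T}"
  have N: "subgroup N G" unfolding N_def using D(1) cT by (rule subgroup_normaliser_in)
  have TN: "T \<subseteq> N"
    using normalises_self[OF T'(1)] normalises_iff_conjugate[OF T'(1) cT] T' S by (auto simp: N_def)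
  have NV: "N \<inter> V \<subseteq> A"
  proof
    fix v assume v: "v \<in> N \<inter> V"
    have vt: "commutator v t \<in> A" if t: "t \<in> T" for t
    proof -
      have "v \<otimes> t \<otimes> inv v \<in> T" using v t by (auto simp: N_def conjugate_def)
      then have "commutator v t \<in> T" unfolding commutator_def
        using t T'(1) by (simp add: subgroup.m_closed subgroup.m_inv_closed)
      moreover have "commutator v t \<in> V"
        using normalises_commutator_left[OF D(2,6) _ c(1), of t v] v t T' S by auto
      ultimately show ?thesis using T' by auto
    qed
    have "commutator v s \<in> A" if s: "s \<in> S" for s
    proof -
      obtain u t where ut: "u \<in> V" "t \<in> T" "s = u \<otimes> t" 
        using complement_factor[OF T s] by blast
      have "commutator v s = commutator v u \<otimes> (u \<otimes> commutator v t \<otimes> inv u)"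
        using ut v c cT by (auto simp: commutator_mult_right subset_iff)
      moreover have "u \<otimes> commutator v t \<otimes> inv u \<in> A"
        using normalisesD[OF D(7) _ vt] ut D(5) by auto
      ultimately show ?thesis using D(8)[of v u] ut v D(3) by (auto simp: subgroup.m_closed)
    qed
    then show "v \<in> A" using fpf v by (auto simp: fixed_point_free_def)
  qed
  \<comment> \<open>Conjugation by \<open>r\<close> permutes the complements in \<open>S\<close>, and \<open>V\<close> is already transitive on
    them.\<close>
  have cover: "\<exists>v\<in>V. \<exists>t\<in>N. r = v \<otimes> t" if r: "r \<in> R" for r
  proof -
    have "complement S V A (conjugate r T)"
      using complement_conjugate[OF secS T] inv[OF r] r c by auto
    then obtain v where v: "v \<in> V" "conjugate v (conjugate r T) = T"
      using T split unfolding splits_uniquely_def by blast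
    then have "v \<otimes> r \<in> N"
      using r c cT D(1,5) by (auto simp: N_def conjugate_mult subset_iff subgroup.m_closed)
    moreover have "r = inv v \<otimes> (v \<otimes> r)" using v r c by (auto simp: word_simps subset_iff)
    ultimately show ?thesis using v D(2) by (meson subgroup.m_inv_closed)
  qed
  have compl: "complement R V A N"
    using N TN T' NV cover by (auto simp: complement_def N_def)
  have conj: "\<exists>v\<in>V. conjugate v U = N" if U: "complement R V A U" for U
  proof -
    have U': "subgroup U G" "A \<subseteq> U" "U \<subseteq> R" "U \<inter> V \<subseteq> A" using U by (auto simp: complement_def)
    have cU: "U \<subseteq> carrier G" using U' by (simp add: subgroup.subset)
    have "complement S V A (U \<inter> S)"
      using complement_Int[OF D(2,4) U S] .
    then obtain v where v: "v \<in> V" "conjugate v (U \<inter> S) = T"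
      using T split unfolding splits_uniquely_def by blast
    have vR: "v \<in> R" using v D(5) by auto
    have vc: "v \<in> carrier G" using v c by auto
    let ?U = "conjugate v U"
    \<comment> \<open>After conjugation, \<open>T\<close> is the intersection with \<open>S\<close>, hence normal in the given
      complement.\<close>
    have T_eq: "T = ?U \<inter> S"
      using v(2) conjugate_Int[OF vc cU c(2)] inv(1)[OF vR] by simp
    have UC: "complement R V A ?U"
      using complement_conjugate[OF sec U vc] inv[OF vR] normalises_iff_conjugate[OF D(1) c(1)]
        normalises_self[OF D(1)] vR by auto
    have U2: "subgroup ?U G" "?U \<subseteq> R" using UC by (auto simp: complement_def)
    have "?U \<subseteq> N"
    proof
      fix u assume u: "u \<in> ?U"
      have "conjugate u ?U = ?U"
        using normalises_self[OF U2(1)] normalises_iff_conjugate[OF U2(1)] u U2 c by auto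
      then have "conjugate u T = T"
        unfolding T_eq using conjugate_Int[of u ?U S] inv(1)[of u] u U2 c by auto
      then show "u \<in> N" using u U2 by (auto simp: N_def)
    qed
    then have "?U = N" using complement_subset_eq[OF D(2) compl UC] by simp
    then show ?thesis using v by auto
  qed
  have "fixed_point_free R V A" using fpf S by (auto simp: fixed_point_free_def)
  with D(2) compl conj show ?thesis by (rule splits_uniquelyI)
qed

text \<open>Subgroups of nilpotent groups are subnormal: starting with \<open>S\<close>, each normaliser absorbs a
  further term of the upper central series of \<open>H\<close> modulo \<open>V\<close>.\<close>

lemma splits_uniquely_subnormal:
  assumes sec: "abelian_section H V A" and nil: "nilpotent_mod H V"
    and S: "subgroup S G" "V \<subseteq> S" "S \<subseteq> H" and split: "splits_uniquely S V A"
  shows "splits_uniquely H V A"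
proof -
  note D = abelian_sectionD[OF sec]
  obtain n where n: "H \<subseteq> upper_central H V n" using nil by (auto simp: nilpotent_mod_def)
  have "\<exists>S. subgroup S G \<and> upper_central H V i \<subseteq> S \<and> S \<subseteq> H \<and> splits_uniquely S V A" for i
  proof (induction i)
    case 0
    then show ?case using S split by auto
  next
    case (Suc i)
    then obtain S where S: "subgroup S G" "upper_central H V i \<subseteq> S" "S \<subseteq> H" "splits_uniquely S V A"
      by blast
    have cS: "S \<subseteq> carrier G" "H \<subseteq> carrier G" using S(1) D(1) by (auto simp: subgroup.subset)
    define R where "R = {h \<in> H. conjugate h S = S}"
    have R: "subgroup R G" unfolding R_def using D(1) cS(1) by (rule subgroup_normaliser_in)
    have "S \<subseteq> R"
      using normalises_self[OF S(1)] normalises_iff_conjugate[OF S(1) cS(1)] S by (auto simp: R_def)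
    have "normalises R S" using normalises_iff_conjugate[OF R cS(1)] by (auto simp: R_def)
    have V: "V \<subseteq> S" using upper_central_mono[OF D(1,2,5,6), of 0 i] S by simp
    have secR: "abelian_section R V A"
      using abelian_section_subgroup[OF sec R] V \<open>S \<subseteq> R\<close> by (auto simp: R_def)
    have "splits_uniquely R V A"
      using splits_uniquely_normal_overgroup[OF secR S(1) V \<open>S \<subseteq> R\<close> \<open>normalises R S\<close> S(4)] .
    moreover have "upper_central H V (Suc i) \<subseteq> R"
    proof
      have U: "subgroup (upper_central H V (Suc i)) G"
        using D by (intro subgroup_upper_central)
      have "normalises (upper_central H V (Suc i)) S" unfolding normalises_def
      proof (intro ballI)
        fix x s assume x: "x \<in> upper_central H V (Suc i)" and s: "s \<in> S"
        then have "commutator x s \<in> S" using S by auto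
        moreover have "x \<otimes> s \<otimes> inv x = commutator x s \<otimes> s"
          using x s cS by (intro conj_conv_commutator) auto
        ultimately show "x \<otimes> s \<otimes> inv x \<in> S" using s S(1) by (simp add: subgroup.m_closed)
      qed
      then have *: "\<forall>x\<in>upper_central H V (Suc i). conjugate x S = S"
        using normalises_iff_conjugate[OF U cS(1)] by simp
      fix x assume "x \<in> upper_central H V (Suc i)"
      then show "x \<in> R" using * by (auto simp: R_def)
    qed
    moreover have "R \<subseteq> H" by (auto simp: R_def)
    ultimately show ?case using R by blast
  qed
  from this[of n] show ?thesis using n by (metis subset_antisym subset_trans)
qed

section \<open>Splitting by a single operator and by submodules\<close>

lemma subgroup_kernel_of_commutator:
  assumes H: "subgroup H G" and A: "subgroup A G" "A \<subseteq> H" "normalises H A" and z: "z \<in> H"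
  shows "subgroup {h \<in> H. commutator h z \<in> A} G"
  using subgroup_commutators_in[OF H A(1,3), of "{z}"] z H by (simp add: subgroup.mem_carrier)

lemma conj_eq_of_commutator_commutes:
  assumes "u \<in> carrier G" "z \<in> carrier G" and c: "u \<otimes> commutator u z = commutator u z \<otimes> u"
  shows "inv u \<otimes> z \<otimes> u = inv (commutator u z) \<otimes> z"
proof -
  let ?c = "commutator u z"
  have "inv u \<otimes> ?c = (inv u \<otimes> (?c \<otimes> u)) \<otimes> inv u" using assms(1,2) by (simp add: m_assoc)
  also have "\<dots> = ?c \<otimes> inv u" using assms(1,2) by (simp flip: c) (simp add: word_simps)
  finally have "?c \<otimes> (inv u \<otimes> z \<otimes> u) = inv u \<otimes> (?c \<otimes> z) \<otimes> u"
    using assms(1,2) by (simp flip: m_assoc)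
  also have "\<dots> = z" using assms(1,2) by (simp add: commutator_def word_simps)
  finally have "inv ?c \<otimes> (?c \<otimes> (inv u \<otimes> z \<otimes> u)) = inv ?c \<otimes> z" by simp
  then show ?thesis using assms(1,2) inv_mult_cancel[of ?c "inv u \<otimes> z \<otimes> u"] by simp
qed

text \<open>The hypotheses say that \<open>1 - z\<close> is bijective on \<open>V/A\<close>. The complement is the centraliser \<open>C\<close> of
  \<open>z\<close> modulo \<open>A\<close>: surjectivity allows every element commuting with \<open>z\<close> modulo \<open>V\<close> to be
  corrected by an element of \<open>V\<close> so that it commutes with \<open>z\<close> modulo \<open>A\<close>, and injectivity is
  \<open>C \<inter> V \<subseteq> A\<close>. Any other complement \<open>T\<close> contains \<open>z\<close> up to conjugation, and then
  \<open>[T, z] \<subseteq> T \<inter> V \<subseteq> A\<close> puts \<open>T\<close> inside \<open>C\<close>.\<close>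

lemma splits_uniquely_centraliser:
  assumes sec: "abelian_section H V A" and z: "z \<in> H"
    and inj: "\<And>v. \<lbrakk>v \<in> V; commutator v z \<in> A\<rbrakk> \<Longrightarrow> v \<in> A"
    and surj: "\<And>w. w \<in> V \<Longrightarrow> \<exists>v\<in>V. w \<otimes> inv (commutator v z) \<in> A"
  shows "splits_uniquely {h \<in> H. commutator h z \<in> V} V A"
proof -
  note D = abelian_sectionD[OF sec]
  define R where "R = {h \<in> H. commutator h z \<in> V}"
  define C where "C = {h \<in> H. commutator h z \<in> A}"
  have AH: "A \<subseteq> H" using D by auto
  have R: "subgroup R G" unfolding R_def using subgroup_kernel_of_commutator[OF D(1,2,5,6) z] .
  have C: "subgroup C G" unfolding C_def using subgroup_kernel_of_commutator[OF D(1,3) AH D(7) z] .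
  obtain K :: "'a set monoid" and p where "quotient_map G K H A p"
    using obtain_quotient_map[OF D(1,3) AH D(7)] .
  then interpret quotient_map G K H A p .
  have VH: "v \<in> H" if "v \<in> V" for v using that D by auto
  have VR: "V \<subseteq> R"
    using normalises_commutator_left[OF D(2,6) z subgroup.subset[OF D(1)]] D by (auto simp: R_def)
  have AC: "A \<subseteq> C"
    using normalises_commutator_left[OF D(3,7) z subgroup.subset[OF D(1)]] D by (auto simp: C_def)
  have zR: "z \<in> R" using z D(2) by (simp add: R_def commutator_def subgroup.one_closed word_simps)
  have surj': "\<exists>v\<in>V. p w = p (commutator v z)" if "w \<in> V" for w
    using surj[OF that] that VH z by (metis p_eq_iff commutator_H)
  have compl: "complement R V A C"
  proof -
    have "\<exists>v\<in>V. \<exists>c\<in>C. r = v \<otimes> c" if r: "r \<in> R" for r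
    proof -
      have rH: "r \<in> H" and rz: "commutator r z \<in> V" using r by (auto simp: R_def)
      obtain v where v: "v \<in> V" "p (commutator r z) = p (commutator v z)"
        using surj'[OF rz] by blast
      have "commutator (inv v \<otimes> r) z \<in> A"
        using v(2) v(1) rH z VH
        by (simp add: p_kernel[symmetric] del: p_kernel)
           (simp add: K.commutator_mult_left K.commutator_inv_left K.word_simps)
      then have "inv v \<otimes> r \<in> C" using v rH VH by (simp add: C_def)
      moreover have "r = v \<otimes> (inv v \<otimes> r)" using v rH VH by (simp add: word_simps)
      ultimately show ?thesis using v by blast
    qed
    then show ?thesis using C AC D inj by (auto simp: complement_def C_def R_def)
  qed
  have conj: "\<exists>v\<in>V. conjugate v T = C" if T: "complement R V A T" for T
  proof -
    have T': "subgroup T G" "A \<subseteq> T" "T \<subseteq> R" "T \<inter> V \<subseteq> A" using T by (auto simp: complement_def)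
    \<comment> \<open>A conjugate of \<open>T\<close> contains \<open>z\<close>: the factor \<open>v\<close> is the commutator of some \<open>u \<in> V\<close>
      with \<open>z\<close> modulo \<open>A\<close>.\<close>
    obtain v t where vt: "v \<in> V" "t \<in> T" "z = v \<otimes> t" using complement_factor[OF T zR] by blast
    have tH: "t \<in> H" using vt T' by (auto simp: R_def)
    obtain u where u: "u \<in> V" "p v = p (commutator u z)" using surj' vt by blast
    have uH: "u \<in> H" "v \<in> H" using u vt VH by auto
    have "commutator u z \<in> V"
      using normalises_commutator_left[OF D(2,6) z subgroup.subset[OF D(1)] u(1)] .
    then have comm: "p u \<otimes>\<^bsub>K\<^esub> p (commutator u z) = p (commutator u z) \<otimes>\<^bsub>K\<^esub> p u"
      using D(8) u z uH by (subst commutator_in_iff[symmetric]) auto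
    have "inv\<^bsub>K\<^esub> (p u) \<otimes>\<^bsub>K\<^esub> p z \<otimes>\<^bsub>K\<^esub> p u = p t"
    proof -
      have "inv\<^bsub>K\<^esub> (p u) \<otimes>\<^bsub>K\<^esub> p z \<otimes>\<^bsub>K\<^esub> p u = inv\<^bsub>K\<^esub> (p v) \<otimes>\<^bsub>K\<^esub> p z"
        using K.conj_eq_of_commutator_commutes[of "p u" "p z"] comm uH z
        unfolding u(2) by simp
      also have "\<dots> = p t"
        using vt(3) uH tH by (simp add: K.word_simps)
      finally show ?thesis .
    qed
    then have "(inv u \<otimes> z \<otimes> u) \<otimes> inv t \<in> A" using p_eq_iff[of "inv u \<otimes> z \<otimes> u" t] uH z tH by simp
    then have "((inv u \<otimes> z \<otimes> u) \<otimes> inv t) \<otimes> t \<in> T" using vt T' by (auto simp: subgroup.m_closed)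
    then have "inv u \<otimes> z \<otimes> u \<in> T" using uH z tH by (simp add: word_simps)
    then have zT: "z \<in> conjugate u T"
      using uH z subgroup.subset[OF T'(1)] by (subst mem_conjugate_iff) auto
    have secR: "abelian_section R V A"
      using abelian_section_subgroup[OF sec R _ VR] by (auto simp: R_def)
    have "conjugate u E = E" if "normalises R E" "E \<subseteq> carrier G" for E
      using that normalises_iff_conjugate[OF R] u VR by auto
    then have "conjugate u R = R" "conjugate u V = V" "conjugate u A = A"
      using abelian_sectionD[OF secR] normalises_self[OF R] by (simp_all add: subgroup.subset)
    then have T1: "complement R V A (conjugate u T)"
      using complement_conjugate[OF secR T, of u] uH by simp
    have "conjugate u T \<subseteq> C"
    proof
      fix t assume t: "t \<in> conjugate u T"
      then have "t \<in> R" using complementD(3)[OF T1] by auto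
      moreover have "commutator t z \<in> conjugate u T"
        using t zT complementD(1)[OF T1] by (simp add: commutator_in_subgroup)
      ultimately show "t \<in> C" using complementD(4)[OF T1] by (auto simp: R_def C_def)
    qed
    then have "conjugate u T = C" using complement_subset_eq[OF D(2) compl T1] by simp
    then show ?thesis using u by blast
  qed
  have "fixed_point_free R V A" using inj zR by (auto simp: fixed_point_free_def)
  with D(2) compl conj show ?thesis unfolding R_def[symmetric] by (rule splits_uniquelyI)
qed

lemma subgroup_product:
  assumes W: "subgroup W G" and U: "subgroup U G" and n: "normalises U W"
  shows "subgroup (W <#> U) G"
proof (rule subgroupI)
  have c: "x \<in> carrier G" if "x \<in> W \<or> x \<in> U" for x
    using that W U by (auto simp: subgroup.mem_carrier)
  show "W <#> U \<subseteq> carrier G" using c by (auto simp: set_mult_def)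
  show "W <#> U \<noteq> {}" using W U by (auto simp: set_mult_def dest!: subgroup.one_closed)
  fix a assume "a \<in> W <#> U"
  then obtain w u where a: "w \<in> W" "u \<in> U" "a = w \<otimes> u" by (auto simp: set_mult_def)
  have "inv a = (inv u \<otimes> inv w \<otimes> u) \<otimes> inv u" using a c by (simp add: word_simps)
  moreover have "inv u \<otimes> inv w \<otimes> u \<in> W"
    using a W normalises_inv[OF n U] by (simp add: subgroup.m_inv_closed)
  moreover have "inv u \<in> U" using a U by (simp add: subgroup.m_inv_closed)
  ultimately show "inv a \<in> W <#> U" unfolding set_mult_def by blast
  fix b assume "b \<in> W <#> U"
  then obtain w' u' where b: "w' \<in> W" "u' \<in> U" "b = w' \<otimes> u'" by (auto simp: set_mult_def)
  have "a \<otimes> b = (w \<otimes> (u \<otimes> w' \<otimes> inv u)) \<otimes> (u \<otimes> u')" using a b c by (simp add: word_simps)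
  moreover have "w \<otimes> (u \<otimes> w' \<otimes> inv u) \<in> W"
    using a b W normalisesD[OF n] by (simp add: subgroup.m_closed)
  moreover have "u \<otimes> u' \<in> U" using a b U by (simp add: subgroup.m_closed)
  ultimately show "a \<otimes> b \<in> W <#> U" unfolding set_mult_def by blast
qed

text \<open>A complement is found in two steps, first of \<open>V/W\<close> in \<open>H/W\<close> and then of \<open>W/A\<close> inside the group
  obtained. For the conjugacy, a complement \<open>U\<close> of \<open>V/A\<close> is recovered from \<open>WU\<close>, a complement of
  \<open>V/W\<close>, in the same two steps.\<close>

lemma splits_uniquely_trans:
  assumes sec: "abelian_section H V A" and W: "subgroup W G" "normalises H W" "A \<subseteq> W" "W \<subseteq> V"
    and VW: "splits_uniquely H V W"
    and WA: "\<And>T. complement H V W T \<Longrightarrow> splits_uniquely T W A"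
  shows "splits_uniquely H V A"
proof -
  note D = abelian_sectionD[OF sec]
  obtain T where T: "complement H V W T" using VW by (auto simp: splits_uniquely_def)
  have T': "subgroup T G" "W \<subseteq> T" "T \<subseteq> H" "T \<inter> V \<subseteq> W" using T by (auto simp: complement_def)
  have c: "H \<subseteq> carrier G" "V \<subseteq> carrier G" "W \<subseteq> carrier G" "A \<subseteq> carrier G" "T \<subseteq> carrier G"
    using D W T' by (auto simp: subgroup.subset)
  obtain S where S: "complement T W A S" using WA[OF T] by (auto simp: splits_uniquely_def)
  have S': "subgroup S G" "A \<subseteq> S" "S \<subseteq> T" "S \<inter> W \<subseteq> A" using S by (auto simp: complement_def)
  have compl: "complement H V A S"
  proof -
    have "\<exists>v\<in>V. \<exists>s\<in>S. h = v \<otimes> s" if h: "h \<in> H" for h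
    proof -
      obtain v t where vt: "v \<in> V" "t \<in> T" "h = v \<otimes> t" using complement_factor[OF T h] by blast
      obtain w s where ws: "w \<in> W" "s \<in> S" "t = w \<otimes> s"
        using complement_factor[OF S vt(2)] by blast
      have "h = (v \<otimes> w) \<otimes> s" using vt ws c S' by (auto simp: m_assoc subset_iff)
      moreover have "v \<otimes> w \<in> V" using vt ws W D(2) by (auto simp: subgroup.m_closed)
      ultimately show ?thesis using ws by blast
    qed
    then show ?thesis using S' T' by (auto simp: complement_def)
  qed
  have conj: "\<exists>v\<in>V. conjugate v U = S" if U: "complement H V A U" for U
  proof -
    have U': "subgroup U G" "A \<subseteq> U" "U \<subseteq> H" "U \<inter> V \<subseteq> A" using U by (auto simp: complement_def)
    have cU: "U \<subseteq> carrier G" using U' by (simp add: subgroup.subset)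
    have UW: "normalises U W" using normalises_mono[OF W(2) U'(3)] .
    have "complement H V W (W <#> U)"
      unfolding complement_def
    proof (intro conjI ballI)
      show "subgroup (W <#> U) G" using W(1) U'(1) UW by (rule subgroup_product)
      show "W \<subseteq> W <#> U"
      proof
        fix w assume "w \<in> W"
        then have "w = w \<otimes> \<one>" using c by auto
        then show "w \<in> W <#> U"
          using \<open>w \<in> W\<close> subgroup.one_closed[OF U'(1)] unfolding set_mult_def by blast
      qed
      show "W <#> U \<subseteq> H" using W D U' by (auto simp: set_mult_def intro!: subgroup.m_closed[OF D(1)])
      show "(W <#> U) \<inter> V \<subseteq> W"
      proof
        fix x assume x: "x \<in> (W <#> U) \<inter> V"
        then obtain w u where wu: "w \<in> W" "u \<in> U" "x = w \<otimes> u" by (auto simp: set_mult_def)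
        have "w \<in> V" "x \<in> V" using wu x W by auto
        then have "inv w \<otimes> x \<in> V" using D(2) by (simp add: subgroup.m_closed subgroup.m_inv_closed)
        moreover have "inv w \<otimes> x = u" using wu c cU by (auto simp: word_simps subset_iff)
        ultimately have "u \<in> W" using wu U' W by auto
        then show "x \<in> W" using wu W by (simp add: subgroup.m_closed)
      qed
      fix h assume "h \<in> H"
      then obtain v u where "v \<in> V" "u \<in> U" "h = v \<otimes> u" using complement_factor[OF U] by blast
      moreover have "u = \<one> \<otimes> u" if "u \<in> U" for u using that cU by auto
      ultimately show "\<exists>v\<in>V. \<exists>t\<in>W <#> U. h = v \<otimes> t"
        using subgroup.one_closed[OF W(1)] unfolding set_mult_def by blast
    qed
    then obtain v where v: "v \<in> V" "conjugate v (W <#> U) = T"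
      using VW T unfolding splits_uniquely_def by blast
    have vc: "v \<in> carrier G" and vH: "v \<in> H" using v c D by auto
    have inv: "conjugate v H = H" "conjugate v V = V" "conjugate v A = A" "conjugate v W = W"
      using vH D(6,7) W(2) normalises_self[OF D(1)] c by (simp_all add: normalises_iff_conjugate[OF D(1)])
    have U1: "complement H V A (conjugate v U)"
      using complement_conjugate[OF sec U vc] inv by simp
    have prod: "\<exists>w\<in>W. \<exists>u\<in>conjugate v U. t = w \<otimes> u" if "t \<in> T" for t
    proof -
      have "t \<in> conjugate v (W <#> U)" using that v(2) by simp
      then obtain w u where wu: "w \<in> W" "u \<in> U" "t = v \<otimes> (w \<otimes> u) \<otimes> inv v"
        by (auto simp: conjugate_def set_mult_def)
      have "t = (v \<otimes> w \<otimes> inv v) \<otimes> (v \<otimes> u \<otimes> inv v)"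
        using wu vc c cU by (auto simp: word_simps subset_iff)
      moreover have "v \<otimes> w \<otimes> inv v \<in> W" using wu W(2) vH by (simp add: normalises_def)
      ultimately show ?thesis using wu by (auto simp: conjugate_def)
    qed
    have "conjugate v U \<subseteq> T"
    proof -
      have "U \<subseteq> W <#> U"
      proof
        fix u assume "u \<in> U"
        then have "u = \<one> \<otimes> u" using cU by auto
        then show "u \<in> W <#> U"
          using \<open>u \<in> U\<close> subgroup.one_closed[OF W(1)] unfolding set_mult_def by blast
      qed
      then show ?thesis using v(2) unfolding conjugate_def by blast
    qed
    then have "complement T W A (conjugate v U)"
      using complementD[OF U1] prod W by (auto simp: complement_def)
    then obtain w where w: "w \<in> W" "conjugate w (conjugate v U) = S"
      using WA[OF T] S unfolding splits_uniquely_def by blast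
    then have "conjugate (w \<otimes> v) U = S" using vc c cU by (auto simp: conjugate_mult)
    moreover have "w \<otimes> v \<in> V" using w v W D(2) by (auto simp: subgroup.m_closed)
    ultimately show ?thesis by blast
  qed
  have "fixed_point_free H V A"
    unfolding fixed_point_free_def
  proof (intro ballI impI)
    fix v assume v: "v \<in> V" "\<forall>h\<in>H. commutator v h \<in> A"
    then have "v \<in> W" using VW W(3) unfolding splits_uniquely_def fixed_point_free_def by blast
    then show "v \<in> A" using v WA[OF T] T'(3) unfolding splits_uniquely_def fixed_point_free_def by blast
  qed
  with D(2) compl conj show ?thesis by (rule splits_uniquelyI)
qed

text \<open>In terms of modules: if \<open>[z, h]\<close> acts trivially, so that \<open>z\<close> and \<open>h\<close> act as commuting operators,
  and if \<open>z\<close> fixes \<open>(1 - h) v\<close>, then \<open>h\<close> fixes \<open>(1 - z) v\<close>, because both statements mean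
  \<open>(1 - h) (1 - z) v = 0\<close>.\<close>

lemma commutators_commute:
  assumes carr: "v \<in> carrier G" "z \<in> carrier G" "h \<in> carrier G"
    and cv: "commutator z h \<otimes> v = v \<otimes> commutator z h"
    and cw: "commutator z h \<otimes> commutator v h = commutator v h \<otimes> commutator z h"
    and cu: "commutator z h \<otimes> commutator v z = commutator v z \<otimes> commutator z h"
    and wz: "commutator v h \<otimes> z = z \<otimes> commutator v h"
    and wu: "commutator v h \<otimes> commutator v z = commutator v z \<otimes> commutator v h"
  shows "commutator v z \<otimes> h = h \<otimes> commutator v z"
proof -
  define c where "c = commutator z h"
  define w where "w = commutator v h"
  define u where "u = commutator v z"
  have carr': "c \<in> carrier G" "w \<in> carrier G" "u \<in> carrier G"
    using carr by (simp_all add: c_def w_def u_def)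
  have inv_comm: "inv a \<otimes> b = b \<otimes> inv a" if "a \<in> carrier G" "b \<in> carrier G" "a \<otimes> b = b \<otimes> a" for a b
  proof -
    have "inv a \<otimes> b = inv a \<otimes> (b \<otimes> a) \<otimes> inv a" using that(1,2) by (simp add: word_simps)
    also have "\<dots> = b \<otimes> inv a" using that(1,2) by (simp flip: that(3)) (simp add: word_simps)
    finally show ?thesis .
  qed
  have one: "commutator a b = \<one>" if "a \<in> carrier G" "b \<in> carrier G" "a \<otimes> b = b \<otimes> a" for a b
    using that by (simp add: commutator_eq_one_iff)
  have dv: "inv c \<otimes> v = v \<otimes> inv c" and dw: "inv c \<otimes> w = w \<otimes> inv c" and du: "inv c \<otimes> u = u \<otimes> inv c"
    and ez: "inv w \<otimes> z = z \<otimes> inv w" and eu: "inv w \<otimes> u = u \<otimes> inv w"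
    using carr carr' assms by (auto intro!: inv_comm simp: c_def w_def u_def)
  have de: "inv w \<otimes> inv c = inv c \<otimes> inv w"
    using inv_comm[of w "inv c"] dw carr' by simp
  have "commutator v (inv c \<otimes> z) = commutator v (inv c) \<otimes> (inv c \<otimes> u \<otimes> inv (inv c))"
    using carr carr' by (simp only: commutator_mult_right inv_closed u_def)
  also have "\<dots> = u" using carr carr' by (simp add: one dv du) (simp add: word_simps)
  finally have 1: "commutator v (inv c \<otimes> z) = u" .
  have "commutator (inv w) (inv c \<otimes> z) = commutator (inv w) (inv c) \<otimes> (inv c \<otimes> commutator (inv w) z \<otimes> inv (inv c))"
    using carr carr' by (simp only: commutator_mult_right inv_closed)
  also have "\<dots> = \<one>" using carr carr' by (simp add: one de ez)
  finally have 2: "commutator (inv w) (inv c \<otimes> z) = \<one>" .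
  have "h \<otimes> u \<otimes> inv h = commutator (h \<otimes> v \<otimes> inv h) (h \<otimes> z \<otimes> inv h)"
    unfolding u_def using carr by (simp add: conj_commutator)
  also have "h \<otimes> v \<otimes> inv h = inv w \<otimes> v"
    using carr by (simp add: w_def commutator_def word_simps)
  also have "h \<otimes> z \<otimes> inv h = inv c \<otimes> z"
    using carr by (simp add: c_def commutator_def word_simps)
  also have "commutator (inv w \<otimes> v) (inv c \<otimes> z) = (inv w \<otimes> u \<otimes> inv (inv w)) \<otimes> \<one>"
    using carr carr' 1 2 by (simp add: commutator_mult_left)
  also have "\<dots> = u" using carr carr' by (simp add: eu) (simp add: word_simps)
  finally have "h \<otimes> u \<otimes> inv h \<otimes> h = u \<otimes> h" by simp
  then show ?thesis using carr carr' by (simp add: word_simps u_def)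
qed

text \<open>The fixed vectors of an operator \<open>z\<close> are permuted by every \<open>h\<close> that commutes with it; as
  operators, \<open>z\<close> and \<open>h\<close> commute when \<open>[z, h]\<close> acts trivially.\<close>

lemma conjugate_commutes:
  assumes carr: "w \<in> carrier G" "z \<in> carrier G" "h \<in> carrier G" and wz: "w \<otimes> z = z \<otimes> w"
    and c: "commutator z h \<otimes> (h \<otimes> w \<otimes> inv h) = (h \<otimes> w \<otimes> inv h) \<otimes> commutator z h"
  shows "(h \<otimes> w \<otimes> inv h) \<otimes> z = z \<otimes> (h \<otimes> w \<otimes> inv h)"
proof -
  let ?c = "commutator z h" and ?w = "h \<otimes> w \<otimes> inv h"
  have z: "z = ?c \<otimes> (h \<otimes> z \<otimes> inv h)" using carr by (simp add: commutator_def word_simps)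
  have "?w \<otimes> (h \<otimes> z \<otimes> inv h) = h \<otimes> (w \<otimes> z) \<otimes> inv h" using carr by (simp add: word_simps)
  also have "\<dots> = (h \<otimes> z \<otimes> inv h) \<otimes> ?w" using carr by (simp add: wz) (simp add: word_simps)
  finally have *: "?w \<otimes> (h \<otimes> z \<otimes> inv h) = (h \<otimes> z \<otimes> inv h) \<otimes> ?w" .
  have "?w \<otimes> z = (?w \<otimes> ?c) \<otimes> (h \<otimes> z \<otimes> inv h)"
    using carr by (subst z) (simp add: m_assoc)
  also have "\<dots> = ?c \<otimes> (?w \<otimes> (h \<otimes> z \<otimes> inv h))" using carr by (simp flip: c) (simp add: m_assoc)
  also have "\<dots> = (?c \<otimes> (h \<otimes> z \<otimes> inv h)) \<otimes> ?w" unfolding * using carr by (simp add: m_assoc)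
  finally show ?thesis by (simp flip: z)
qed

section \<open>Isolated subgroups and rank\<close>

text \<open>A normal subgroup is isolated exactly when the quotient is torsion-free. In a finite-dimensional
  rational vector space the isolated subgroups are the subspaces.\<close>

definition isolated :: "'a set \<Rightarrow> 'a set \<Rightarrow> bool"
  where "isolated M A \<longleftrightarrow> subgroup A G \<and> A \<subseteq> M \<and> (\<forall>x\<in>M. \<forall>n::nat. n \<ge> 1 \<longrightarrow> x [^] n \<in> A \<longrightarrow> x \<in> A)"

text \<open>As \<open>V/A\<close> is abelian, \<open>[v\<^sup>n, x]\<close> and \<open>[v, x]\<^sup>n\<close> agree modulo \<open>A\<close>.\<close>

lemma isolated_commutators_in:
  assumes sec: "abelian_section H V A" and V: "isolated M V" and A: "isolated M A" and E: "E \<subseteq> H"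
  shows "isolated M {v \<in> V. \<forall>x\<in>E. commutator v x \<in> A}"
proof -
  note D = abelian_sectionD[OF sec]
  have AH: "A \<subseteq> H" and VH: "V \<subseteq> H" using D by auto
  obtain K :: "'a set monoid" and p where "quotient_map G K H A p"
    using obtain_quotient_map[OF D(1,3) AH D(7)] .
  then interpret quotient_map G K H A p .
  have "subgroup {v \<in> V. \<forall>x\<in>E. commutator v x \<in> A} G"
    using subgroup_commutators_in[OF D(2,3) normalises_mono[OF D(7,5)], of E] E
      subgroup.subset[OF D(1)] by blast
  moreover have "x \<in> V \<and> (\<forall>e\<in>E. commutator x e \<in> A)"
    if x: "x \<in> M" "n \<ge> 1" "x [^] n \<in> V" "\<forall>e\<in>E. commutator (x [^] n) e \<in> A" for x and n :: nat
  proof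
    show xV: "x \<in> V" using V x by (auto simp: isolated_def)
    show "\<forall>e\<in>E. commutator x e \<in> A"
    proof
      fix e assume e: "e \<in> E"
      have H: "x \<in> H" "e \<in> H" using xV e E VH by auto
      have c: "commutator x e \<in> V"
        using normalises_commutator_left[OF D(2,6) H(2) subgroup.subset[OF D(1)] xV] .
      then have "K.commutator (p x) (p e) \<otimes>\<^bsub>K\<^esub> p x = p x \<otimes>\<^bsub>K\<^esub> K.commutator (p x) (p e)"
        using commutator_in_iff[of "commutator x e" x] D(8)[OF c xV] H by simp
      then have "K.commutator (p x [^]\<^bsub>K\<^esub> n) (p e) = K.commutator (p x) (p e) [^]\<^bsub>K\<^esub> n"
        using H by (intro K.commutator_pow_left) auto
      then have "p (commutator x e [^] n) = p (commutator (x [^] n) e)" using H by simp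
      then have "commutator x e [^] n \<in> A"
        using x(4) e H p_kernel by (metis H_pow commutator_H)
      then show "commutator x e \<in> A" using A V c x(2) unfolding isolated_def by blast
    qed
  qed
  ultimately show ?thesis using V unfolding isolated_def by blast
qed

end

text \<open>The function \<open>rk\<close> takes the place of the dimension over the rationals.\<close>

locale finite_rank_divisible = group G for G (structure) +
  fixes M :: "'a set" and rk :: "'a set \<Rightarrow> nat"
  assumes M: "subgroup M G"
    and root: "\<And>x n. \<lbrakk>x \<in> M; n \<ge> 1\<rbrakk> \<Longrightarrow> \<exists>y\<in>M. y [^] (n::nat) = x"
    and rk_less: "\<And>A B. \<lbrakk>isolated M A; isolated M B; A \<subset> B\<rbrakk> \<Longrightarrow> rk A < rk B"
begin

lemma rk_mono: "\<lbrakk>isolated M A; isolated M B; A \<subseteq> B\<rbrakk> \<Longrightarrow> rk A \<le> rk B"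
  using rk_less by (cases "A = B") force+

text \<open>An injective endomorphism of a finite-dimensional space is surjective. The images \<open>im k\<close> of the
  powers of \<open>1 - z\<close> form a descending chain of isolated subgroups, because each is again
  divisible modulo \<open>A\<close>. The rank makes the chain stationary, and injectivity carries an equality
  \<open>im (Suc j) = im j\<close> down to \<open>j = 0\<close>.\<close>

lemma commutator_with_surj:
  assumes sec: "abelian_section H V A" and V: "isolated M V" and A: "isolated M A" and z: "z \<in> H"
    and inj: "\<And>v. \<lbrakk>v \<in> V; commutator v z \<in> A\<rbrakk> \<Longrightarrow> v \<in> A"
    and w: "w \<in> V"
  shows "\<exists>v\<in>V. w \<otimes> inv (commutator v z) \<in> A"
proof -
  note D = abelian_sectionD[OF sec]
  have AH: "A \<subseteq> H" and VH: "\<And>v. v \<in> V \<Longrightarrow> v \<in> H" using D by auto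
  obtain K :: "'a set monoid" and p where "quotient_map G K H A p"
    using obtain_quotient_map[OF D(1,3) AH D(7)] .
  then interpret quotient_map G K H A p .
  let ?f = "\<lambda>v. commutator v z"
  have fV: "?f v \<in> V" if "v \<in> V" for v
    using normalises_commutator_left[OF D(2,6) z subgroup.subset[OF D(1)] that] .
  have comm: "p u \<otimes>\<^bsub>K\<^esub> p v = p v \<otimes>\<^bsub>K\<^esub> p u" if "u \<in> V" "v \<in> V" for u v
    using commutator_in_iff[of u v] D(8)[OF that] that VH by simp
  have f_mult: "p (?f (u \<otimes> v)) = p (?f u) \<otimes>\<^bsub>K\<^esub> p (?f v)" if "u \<in> V" "v \<in> V" for u v
  proof -
    have "p (?f (u \<otimes> v)) = (p u \<otimes>\<^bsub>K\<^esub> p (?f v)) \<otimes>\<^bsub>K\<^esub> inv\<^bsub>K\<^esub> p u \<otimes>\<^bsub>K\<^esub> p (?f u)"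
      using that z VH by (simp add: commutator_mult_left)
    also have "\<dots> = p (?f v) \<otimes>\<^bsub>K\<^esub> p (?f u)"
      unfolding comm[OF that(1) fV[OF that(2)]] using that z VH by (simp add: K.word_simps)
    finally show ?thesis using comm fV that by simp
  qed
  have f_one: "p (?f \<one>) = \<one>\<^bsub>K\<^esub>" using z by (simp add: commutator_def word_simps)
  have f_inv: "p (?f (inv v)) = inv\<^bsub>K\<^esub> p (?f v)" if "v \<in> V" for v
  proof -
    have "inv v \<in> V" using that D(2) by (simp add: subgroup.m_inv_closed)
    then have "p (?f (inv v)) \<otimes>\<^bsub>K\<^esub> p (?f v) = \<one>\<^bsub>K\<^esub>"
      using f_mult[of "inv v" v] f_one that VH by simp
    then show ?thesis
      using K.inv_equality[of "p (?f (inv v))" "p (?f v)"] that VH z by simp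
  qed
  define im where "im = rec_nat V (\<lambda>_ E. {w \<in> V. \<exists>d\<in>E. p w = p (?f d)})"
  have im_0: "im 0 = V" and im_Suc: "im (Suc k) = {w \<in> V. \<exists>d\<in>im k. p w = p (?f d)}" for k
    by (simp_all add: im_def)
  have imV: "im k \<subseteq> V" for k by (cases k) (auto simp: im_0 im_Suc)
  have iso: "isolated M (im k)" for k
  proof (induction k)
    case 0
    then show ?case using V by (simp add: im_0)
  next
    case (Suc k)
    then have im_k: "subgroup (im k) G" by (simp add: isolated_def)
    have "subgroup (im (Suc k)) G"
    proof (rule subgroupI)
      show "im (Suc k) \<subseteq> carrier G" using imV[of "Suc k"] VH by auto
      have "\<one> \<in> im (Suc k)"
        using f_one subgroup.one_closed[OF im_k] subgroup.one_closed[OF D(2)] by (auto simp: im_Suc)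
      then show "im (Suc k) \<noteq> {}" by auto
      fix a assume "a \<in> im (Suc k)"
      then obtain d where d: "a \<in> V" "d \<in> im k" "p a = p (?f d)" by (auto simp: im_Suc)
      have "d \<in> V" using d imV by auto
      have "p (inv a) = p (?f (inv d))"
        using f_inv[OF \<open>d \<in> V\<close>] d VH by (simp del: p_commutator)
      then show "inv a \<in> im (Suc k)"
        using d im_k D(2) by (auto simp: im_Suc subgroup.m_inv_closed)
      fix b assume "b \<in> im (Suc k)"
      then obtain e where e: "b \<in> V" "e \<in> im k" "p b = p (?f e)" by (auto simp: im_Suc)
      have "p (a \<otimes> b) = p (?f (d \<otimes> e))" using d e VH \<open>d \<in> V\<close> imV[of k] f_mult[of d e]
        by (simp del: p_commutator add: subset_iff)
      then show "a \<otimes> b \<in> im (Suc k)" using d e im_k D(2) by (auto simp: im_Suc subgroup.m_closed)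
    qed
    moreover have "x \<in> im (Suc k)" if x: "x \<in> M" "n \<ge> 1" "x [^] n \<in> im (Suc k)" for x and n :: nat
    proof -
      obtain d where d: "x [^] n \<in> V" "d \<in> im k" "p (x [^] n) = p (?f d)" using x by (auto simp: im_Suc)
      have xV: "x \<in> V" using V x d unfolding isolated_def by blast
      have "d \<in> M" using d imV V by (auto simp: isolated_def)
      then obtain e where e: "e \<in> M" "e [^] n = d" using root x(2) by blast
      then have eD: "e \<in> im k" using Suc x(2) d unfolding isolated_def by blast
      then have eV: "e \<in> V" using imV by auto
      have H: "x \<in> H" "e \<in> H" using xV eV VH by auto
      have "K.commutator (p e) (p z) \<otimes>\<^bsub>K\<^esub> p e = p e \<otimes>\<^bsub>K\<^esub> K.commutator (p e) (p z)"
        using comm[OF fV[OF eV] eV] H z by simp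
      then have "K.commutator (p e [^]\<^bsub>K\<^esub> n) (p z) = K.commutator (p e) (p z) [^]\<^bsub>K\<^esub> n"
        using H z by (intro K.commutator_pow_left) auto
      then have pow: "p x [^]\<^bsub>K\<^esub> n = p (?f e) [^]\<^bsub>K\<^esub> n" using d(3) e(2)[symmetric] H z by simp
      have fe: "?f e \<in> V" "?f e \<in> H" using fV eV VH by auto
      have "p x \<otimes>\<^bsub>K\<^esub> p (inv (?f e)) = p (inv (?f e)) \<otimes>\<^bsub>K\<^esub> p x"
        using comm[of x "inv (?f e)"] xV fe D(2) by (simp add: subgroup.m_inv_closed)
      then have "(p x \<otimes>\<^bsub>K\<^esub> p (inv (?f e))) [^]\<^bsub>K\<^esub> n = p x [^]\<^bsub>K\<^esub> n \<otimes>\<^bsub>K\<^esub> p (inv (?f e)) [^]\<^bsub>K\<^esub> n"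
        using H fe by (intro K.pow_mult_distrib) auto
      also have "\<dots> = \<one>\<^bsub>K\<^esub>" using pow fe H by (simp del: p_commutator add: K.nat_pow_inv)
      finally have "(x \<otimes> inv (?f e)) [^] n \<in> A" using H fe by (simp flip: p_kernel)
      moreover have "x \<otimes> inv (?f e) \<in> M"
        using xV fe V D(2) by (auto simp: isolated_def subgroup.m_closed subgroup.m_inv_closed)
      ultimately have "x \<otimes> inv (?f e) \<in> A" using A x(2) unfolding isolated_def by blast
      then have "p x = p (?f e)" using p_eq_iff[OF H(1) fe(2)] by simp
      then show ?thesis using xV eD by (auto simp: im_Suc)
    qed
    ultimately show ?case using V imV[of "Suc k"] by (auto simp: isolated_def)
  qed
  have dec: "im (Suc k) \<subseteq> im k" for k
    by (induction k) (auto simp: im_0 im_Suc)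
  obtain k where k: "\<And>j. rk (im k) \<le> rk (im j)"
    using ex_has_least_nat[of "\<lambda>_. True" 0 "\<lambda>k. rk (im k)"] by blast
  have stable: "im (Suc k) = im k"
    using rk_less[OF iso iso, of "Suc k" k] dec[of k] k[of "Suc k"] by fastforce
  have "im (Suc j) = im j \<Longrightarrow> im (Suc 0) = im 0" for j
  proof (induction j)
    case (Suc j)
    have "im j \<subseteq> im (Suc j)"
    proof
      fix d assume d: "d \<in> im j"
      then have dV: "d \<in> V" using imV by auto
      then have "?f d \<in> im (Suc (Suc j))" unfolding Suc.prems using d fV by (auto simp: im_Suc)
      then obtain e where e: "e \<in> im (Suc j)" "p (?f d) = p (?f e)" by (auto simp: im_Suc[of "Suc j"])
      then have eV: "e \<in> V" using imV by auto
      have "?f (d \<otimes> inv e) \<in> A"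
      proof -
        have "inv e \<in> V" using eV D(2) by (simp add: subgroup.m_inv_closed)
        then have "p (?f (d \<otimes> inv e)) = p (?f e) \<otimes>\<^bsub>K\<^esub> inv\<^bsub>K\<^esub> p (?f e)"
          using f_mult[OF dV] f_inv[OF eV] e(2) by simp
        also have "\<dots> = \<one>\<^bsub>K\<^esub>" using fV[OF eV] VH by (simp del: p_commutator)
        finally show ?thesis using dV eV z VH by (simp del: p_commutator flip: p_kernel)
      qed
      then have "d \<otimes> inv e \<in> A" using inj dV eV D(2)
        by (simp add: subgroup.m_closed subgroup.m_inv_closed)
      then have "p d = p e" using p_eq_iff dV eV VH by simp
      then show "d \<in> im (Suc j)" using e dV by (auto simp: im_Suc)
    qed
    then show ?case using Suc.IH dec[of j] by blast
  qed simp
  then have "w \<in> im (Suc 0)" using stable w im_0 by blast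
  then obtain v where "v \<in> V" "p w = p (?f v)" by (auto simp: im_Suc im_0)
  then show ?thesis using p_eq_iff[of w "?f v"] w VH z by auto
qed

end

section \<open>Splitting of fixed-point-free sections\<close>

lemma (in group) splits_uniquely_trivial:
  assumes sec: "abelian_section H V V"
  shows "splits_uniquely H V V"
proof -
  note D = abelian_sectionD[OF sec]
  have c: "H \<subseteq> carrier G" using D(1) by (rule subgroup.subset)
  have one: "h = \<one> \<otimes> h" if "h \<in> H" for h using that c by auto
  have H: "complement H V V H"
    using D one subgroup.one_closed[OF D(2)] unfolding complement_def by blast
  show ?thesis
  proof (rule splits_uniquelyI[OF D(2) H])
    fix U assume U: "complement H V V U"
    then have "U = H" using complement_subset_eq[OF D(2) H U] complementD(3)[OF U] by blast
    then show "\<exists>v\<in>V. conjugate v U = H"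
      using conjugate_one[OF c] subgroup.one_closed[OF D(2)] by auto
  qed (auto simp: fixed_point_free_def)
qed

context finite_rank_divisible
begin

text \<open>Induction on the dimension of \<open>V/A\<close>. If \<open>V \<noteq> A\<close> then \<open>H\<close> acts nontrivially, so there is a first
  term of the upper central series of \<open>H\<close> modulo \<open>V\<close> that acts nontrivially, and some \<open>z\<close> in it
  does. All \<open>[z, h]\<close> act trivially, hence \<open>1 - z\<close> is an endomorphism of the module; let \<open>W/A\<close> be
  its kernel. If \<open>W = A\<close>, the centraliser of \<open>z\<close> modulo \<open>V\<close> splits uniquely and is subnormal in
  \<open>H\<close>. Otherwise \<open>W/A\<close> and \<open>V/W\<close>, which is isomorphic to the image of \<open>1 - z\<close>, are proper and
  again without fixed points.

  The second case does occur for every \<open>z\<close>: no element of the Klein four-group acts without fixed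
  vectors on the sum of its three nontrivial characters, although the group does.\<close>

lemma splits_uniquely_of_fixed_point_free:
  assumes "abelian_section H V A" "isolated M V" "isolated M A"
    and "nilpotent_mod H V" "fixed_point_free H V A"
  shows "splits_uniquely H V A"
  using assms
proof (induction "rk V - rk A" arbitrary: H V A rule: less_induct)
  case less
  note sec = less.prems(1) and V = less.prems(2) and A = less.prems(3)
    and nil = less.prems(4) and fpf = less.prems(5)
  note D = abelian_sectionD[OF sec]
  show ?case
  proof (cases "A = V")
    case True
    then show ?thesis using splits_uniquely_trivial sec by simp
  next
    case False
    have Hc: "H \<subseteq> carrier G" using D(1) by (rule subgroup.subset)
    have AH: "A \<subseteq> H" and VH: "\<And>v. v \<in> V \<Longrightarrow> v \<in> H" using D by auto
    obtain K :: "'a set monoid" and p where "quotient_map G K H A p"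
      using obtain_quotient_map[OF D(1,3) AH D(7)] .
    then interpret quotient_map G K H A p .
    let ?U = "upper_central H V"
    obtain n where n: "H \<subseteq> ?U n" using nil by (auto simp: nilpotent_mod_def)
    define P where "P i \<longleftrightarrow> (\<exists>z\<in>?U i. \<exists>v\<in>V. commutator v z \<notin> A)" for i
    have "\<exists>v\<in>V. \<exists>h\<in>H. commutator v h \<notin> A"
      using fpf False D(4) unfolding fixed_point_free_def by blast
    then have "P n" using n unfolding P_def by blast
    moreover have "\<not> P 0" using D(8) by (auto simp: P_def)
    \<comment> \<open>The first term of the central series with a nontrivial action: commutators of its
      elements lie in the previous term.\<close>
    ultimately obtain j where j: "P (Suc j)" "\<not> P j"
      using ex_least_nat_less[of P n] by auto
    then obtain z v0 where z: "z \<in> ?U (Suc j)" and v0: "v0 \<in> V" "commutator v0 z \<notin> A"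
      by (auto simp: P_def)
    have zH: "z \<in> H" using z by simp
    have act: "commutator v (commutator z h) \<in> A" if "v \<in> V" "h \<in> H" for v h
      using z j(2) that by (auto simp: P_def)
    define W where "W = {v \<in> V. \<forall>x\<in>{z}. commutator v x \<in> A}"
    have W_iff: "v \<in> W \<longleftrightarrow> v \<in> V \<and> commutator v z \<in> A" for v by (auto simp: W_def)
    have W: "isolated M W"
      unfolding W_def using zH by (intro isolated_commutators_in[OF sec V A]) simp
    have W': "subgroup W G" using W by (simp add: isolated_def)
    have AW: "A \<subseteq> W"
      using normalises_commutator_left[OF D(3,7) zH Hc] D(4) by (auto simp: W_iff)
    have WV: "W \<subset> V" using v0 by (auto simp: W_iff)
    have c_comm: "K.commutator (p z) (p h) \<otimes>\<^bsub>K\<^esub> p v = p v \<otimes>\<^bsub>K\<^esub> K.commutator (p z) (p h)"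
      if "v \<in> V" "h \<in> H" for v h
      using act[OF that] commutator_in_iff[of v "commutator z h"] that VH zH by simp
    have V_comm: "p u \<otimes>\<^bsub>K\<^esub> p v = p v \<otimes>\<^bsub>K\<^esub> p u" if "u \<in> V" "v \<in> V" for u v
      using commutator_in_iff[of u v] D(8)[OF that] that VH by simp
    have nW: "normalises H W"
      unfolding normalises_def
    proof (intro ballI)
      fix h w assume h: "h \<in> H" and w: "w \<in> W"
      have wV: "w \<in> V" and wz: "p w \<otimes>\<^bsub>K\<^esub> p z = p z \<otimes>\<^bsub>K\<^esub> p w"
        using w commutator_in_iff[of w z] VH zH by (auto simp: W_iff)
      have hw: "h \<otimes> w \<otimes> inv h \<in> V" using normalisesD[OF D(6) h wV] .
      have "K.commutator (p z) (p h) \<otimes>\<^bsub>K\<^esub> p (h \<otimes> w \<otimes> inv h) = p (h \<otimes> w \<otimes> inv h) \<otimes>\<^bsub>K\<^esub> K.commutator (p z) (p h)"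
        using c_comm[OF hw h] .
      then have "p (h \<otimes> w \<otimes> inv h) \<otimes>\<^bsub>K\<^esub> p z = p z \<otimes>\<^bsub>K\<^esub> p (h \<otimes> w \<otimes> inv h)"
        using K.conjugate_commutes[of "p w" "p z" "p h"] wz h wV VH zH by simp
      then show "h \<otimes> w \<otimes> inv h \<in> W"
        using hw VH[OF hw] zH commutator_in_iff[of "h \<otimes> w \<otimes> inv h" z] by (simp add: W_iff)
    qed
    show ?thesis
    proof (cases "W = A")
      case True
      then have inj: "v \<in> A" if "v \<in> V" "commutator v z \<in> A" for v using that W_iff[of v] by blast
      have "splits_uniquely {h \<in> H. commutator h z \<in> V} V A"
        by (rule splits_uniquely_centraliser[OF sec zH inj commutator_with_surj[OF sec V A zH inj]])
      moreover have "V \<subseteq> {h \<in> H. commutator h z \<in> V}"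
        using normalises_commutator_left[OF D(2,6) zH Hc] D(5) by auto
      ultimately show ?thesis
        by (intro splits_uniquely_subnormal[OF sec nil subgroup_kernel_of_commutator[OF D(1,2,5,6) zH]])
          auto
    next
      case False
      have rk: "rk A < rk W" "rk W < rk V"
        using rk_less[OF A W] rk_less[OF W V] AW False WV by auto
      have secVW: "abelian_section H V W"
        using sec W' nW AW WV by (auto simp: abelian_section_def)
      have fpfVW: "fixed_point_free H V W"
        unfolding fixed_point_free_def
      proof (intro ballI impI)
        fix v assume v: "v \<in> V" "\<forall>h\<in>H. commutator v h \<in> W"
        have vz: "commutator v z \<in> V"
          using normalises_commutator_left[OF D(2,6) zH Hc v(1)] .
        have "commutator (commutator v z) h \<in> A" if h: "h \<in> H" for h
        proof -
          have vh: "commutator v h \<in> V" "commutator (commutator v h) z \<in> A"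
            using v h by (auto simp: W_iff)
          have "K.commutator (p v) (p z) \<otimes>\<^bsub>K\<^esub> p h = p h \<otimes>\<^bsub>K\<^esub> K.commutator (p v) (p z)"
          proof (rule K.commutators_commute)
            show "K.commutator (p v) (p h) \<otimes>\<^bsub>K\<^esub> p z = p z \<otimes>\<^bsub>K\<^esub> K.commutator (p v) (p h)"
              using vh(2) commutator_in_iff[of "commutator v h" z] v(1) VH h zH by simp
          qed (use c_comm[OF _ h, of v] c_comm[OF _ h, of "commutator v z"]
                  c_comm[OF _ h, of "commutator v h"] V_comm[OF vh(1) vz] v(1) vz vh(1) VH zH h in simp_all)
          then show ?thesis
            using commutator_in_iff[of "commutator v z" h] v(1) VH zH h by simp
        qed
        then have "commutator v z \<in> A" using fpf vz by (auto simp: fixed_point_free_def)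
        then show "v \<in> W" using v by (simp add: W_iff)
      qed
      have VW: "splits_uniquely H V W"
        using less.hyps[OF _ secVW V W nil fpfVW] rk by simp
      have WA: "splits_uniquely T W A" if T: "complement H V W T" for T
      proof -
        note T' = complementD[OF T]
        have Tc: "T \<subseteq> carrier G" using T'(1) by (rule subgroup.subset)
        have "commutator u v \<in> A" if "u \<in> W" "v \<in> W" for u v using D(8)[of u v] that WV by blast
        then have "abelian_section T W A"
          unfolding abelian_section_def
          using D(3) T'(1,2) W' AW normalises_mono[OF nW T'(3)] normalises_mono[OF D(7) T'(3)]
          by blast
        moreover have "nilpotent_mod T W"
        proof -
          have "T \<inter> V = W" using T' WV by auto
          then show ?thesis using nilpotent_mod_restrict[OF T'(1,3) nil] by simp
        qed
        moreover have "fixed_point_free T W A"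
          unfolding fixed_point_free_def
        proof (intro ballI impI)
          fix w assume w: "w \<in> W" "\<forall>t\<in>T. commutator w t \<in> A"
          have wV: "w \<in> V" using w WV by auto
          have "commutator w h \<in> A" if h: "h \<in> H" for h
          proof -
            obtain v t where vt: "v \<in> V" "t \<in> T" "h = v \<otimes> t" using complement_factor[OF T h] .
            have "commutator w h = commutator w v \<otimes> (v \<otimes> commutator w t \<otimes> inv v)"
              using vt wV VH Tc by (simp add: commutator_mult_right subset_iff)
            then show ?thesis
              using D(3) D(8)[OF wV vt(1)] normalisesD[OF D(7) VH[OF vt(1)], of "commutator w t"] w(2) vt(2)
              by (simp add: subgroup.m_closed)
          qed
          then show "w \<in> A" using fpf wV by (auto simp: fixed_point_free_def)
        qed
        ultimately show ?thesis using less.hyps[OF _ _ W A] rk by simp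
      qed
      show ?thesis using splits_uniquely_trans[OF sec W' nW AW _ VW WA] WV by blast
    qed
  qed
qed

end

context group
begin

section \<open>Rank from the Hirsch length\<close>

lemma power_relation_of_infinite_order:
  assumes G: "cyclic_group G \<or> locally_finite G" and x: "x \<in> carrier G" and y: "y \<in> carrier G"
    and inf: "\<And>k::nat. k \<ge> 1 \<Longrightarrow> x [^] k \<noteq> \<one>"
  shows "\<exists>(s::nat) (t::int). s \<ge> 1 \<and> y [^] s \<otimes> x [^] t = \<one>"
  using G
proof
  assume "cyclic_group G"
  then obtain g where g: "g \<in> carrier G" and gen: "carrier G = range (\<lambda>n::int. g [^] n)"
    by (auto simp: cyclic_group)
  obtain m l :: int where ml: "x = g [^] m" "y = g [^] l" using x y gen by (metis rangeE)
  have "m \<noteq> 0" using inf[of 1] ml g by auto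
  \<comment> \<open>The exponents \<open>m\<close> of \<open>y\<close> and \<open>- l\<close> of \<open>x\<close> cancel; both change sign if \<open>m\<close> is
    negative.\<close>
  have "y [^] nat \<bar>m\<bar> \<otimes> x [^] (- l * sgn m) = g [^] (l * \<bar>m\<bar> + m * (- l * sgn m))"
    using g ml by (simp only: int_pow_mult) (simp add: int_pow_pow flip: int_pow_int)
  also have "l * \<bar>m\<bar> + m * (- l * sgn m) = 0" by (simp add: abs_sgn)
  finally have "y [^] nat \<bar>m\<bar> \<otimes> x [^] (- l * sgn m) = \<one>" by simp
  moreover have "nat \<bar>m\<bar> \<ge> 1" using \<open>m \<noteq> 0\<close> by linarith
  ultimately show ?thesis by blast
next
  assume "locally_finite G"
  then have fin: "finite (generate G {x})" using x by (auto simp: locally_finite_def)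
  have "range (\<lambda>k::nat. x [^] k) \<subseteq> generate G {x}"
  proof safe
    fix k :: nat
    show "x [^] k \<in> generate G {x}"
      using x by (auto simp: generate_pow intro!: exI[of _ "int k"] int_pow_int[symmetric])
  qed
  then have "\<not> inj (\<lambda>k::nat. x [^] k)"
    using fin finite_subset finite_imageD infinite_UNIV_nat by blast
  then obtain i j :: nat where "i < j" "x [^] i = x [^] j"
    unfolding inj_def by (metis linorder_neqE_nat)
  moreover have "x [^] i \<otimes> x [^] (j - i) = x [^] (i + (j - i))" using x by (rule nat_pow_mult)
  ultimately have "x [^] i \<otimes> x [^] (j - i) = x [^] i \<otimes> \<one>" using x by simp
  then have "x [^] (j - i) = \<one>" using x by (simp only: l_cancel nat_pow_closed one_closed)
  moreover have "j - i \<ge> 1" using \<open>i < j\<close> by simp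
  ultimately show ?thesis using inf[of "j - i"] by blast
qed

lemma subgroup_nat_pow_closed: "\<lbrakk>subgroup H G; h \<in> H\<rbrakk> \<Longrightarrow> h [^] (k::nat) \<in> H"
  using subgroup_int_pow_closed[of H h "int k"] by (simp add: int_pow_int)

end

lemma (in quotient_map) power_relation_mod:
  assumes K: "cyclic_group K \<or> locally_finite K" and a: "a \<in> H" and b: "b \<in> H"
    and inf: "\<And>k::nat. k \<ge> 1 \<Longrightarrow> a [^] k \<notin> A"
  shows "\<exists>(s::nat) (t::int). s \<ge> 1 \<and> b [^] s \<otimes> a [^] t \<in> A"
proof -
  have p_int_pow: "p (a [^] t) = p a [^]\<^bsub>K\<^esub> t" "a [^] t \<in> H" for t :: int
  proof -
    show "p (a [^] t) = p a [^]\<^bsub>K\<^esub> t"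
      using a
      by (cases t rule: int_cases2)
        (simp_all add: G.int_pow_neg K.int_pow_neg int_pow_int)
    show "a [^] t \<in> H" using H a by (rule G.subgroup_int_pow_closed)
  qed
  have "p a [^]\<^bsub>K\<^esub> k \<noteq> \<one>\<^bsub>K\<^esub>" if "k \<ge> 1" for k :: nat
    using inf[OF that] p_kernel[OF H_pow[OF a]] unfolding p_pow[OF a] by blast
  then obtain s :: nat and t :: int where "s \<ge> 1" "p b [^]\<^bsub>K\<^esub> s \<otimes>\<^bsub>K\<^esub> p a [^]\<^bsub>K\<^esub> t = \<one>\<^bsub>K\<^esub>"
    using K.power_relation_of_infinite_order[OF K, of "p a" "p b"] a b by auto
  then show ?thesis
    using p_kernel[of "b [^] s \<otimes> a [^] t"] a b by (auto simp: p_int_pow)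
qed

context group
begin

text \<open>The rank of \<open>A\<close> is the number of factors of a fixed series of \<open>M\<close> in which the image of \<open>A\<close> has
  an element of infinite order. To see that it is strictly monotone, let \<open>A \<subseteq> B\<close> be isolated
  with the same set of such factors; then \<open>B \<inter> S\<^sub>i \<subseteq> A\<close> for all \<open>i\<close>. Indeed, if \<open>b \<in> B \<inter> S\<^sub>i\<^sub>+\<^sub>1\<close>
  has infinite order modulo \<open>S\<^sub>i\<close>, then so has some \<open>a \<in> A \<inter> S\<^sub>i\<^sub>+\<^sub>1\<close>, and in the cyclic factor a
  nontrivial power of \<open>b\<close> is a power of \<open>a\<close> modulo \<open>S\<^sub>i\<close>. In either case a nontrivial power of
  \<open>b\<close> lies in \<open>A\<close> by induction, and \<open>A\<close> is isolated.\<close>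

lemma rank_function_of_finite_hirsch_length:
  assumes M: "subgroup M G" and fin: "hirsch_length (G\<lparr>carrier := M\<rparr>) < \<infinity>"
  obtains rk :: "'a set \<Rightarrow> nat"
  where "\<And>A B. \<lbrakk>isolated M A; isolated M B; A \<subset> B\<rbrakk> \<Longrightarrow> rk A < rk B"
proof -
  obtain n S where "hirsch_series (G\<lparr>carrier := M\<rparr>) n S"
    using fin by (auto simp: hirsch_length_def split: if_splits)
  then have S0: "S 0 = {\<one>}" and Sn: "S n = M"
    and S_sub: "\<And>i. i \<le> n \<Longrightarrow> subgroup (S i) (G\<lparr>carrier := M\<rparr>)"
    and S_norm: "\<And>i. i < n \<Longrightarrow> S i \<lhd> G\<lparr>carrier := S (Suc i)\<rparr>"
    and S_fac: "\<And>i. i < n \<Longrightarrow> cyclic_group (G\<lparr>carrier := S (Suc i)\<rparr> Mod S i) \<or>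
                  locally_finite (G\<lparr>carrier := S (Suc i)\<rparr> Mod S i)"
    by (auto simp: hirsch_series_def series_factor_def)
  have S: "subgroup (S i) G" if "i \<le> n" for i
    using incl_subgroup[OF M S_sub[OF that]] .
  \<comment> \<open>The factors in which the image of \<open>A\<close> has an element of infinite order; these
    factors are infinite cyclic.\<close>
  define J where "J A = {i. i < n \<and> (\<exists>a\<in>A \<inter> S (Suc i). \<forall>k::nat. k \<ge> 1 \<longrightarrow> a [^] k \<notin> S i)}" for A
  have J_fin: "finite (J A)" for A by (simp add: J_def)
  have "card (J A) < card (J B)" if A: "isolated M A" and B: "isolated M B" and AB: "A \<subset> B" for A B
  proof (rule psubset_card_mono[OF J_fin])
    have "J A \<subseteq> J B" using AB by (auto simp: J_def)
    moreover have "J A \<noteq> J B"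
    proof
      assume JJ: "J A = J B"
      have grp: "subgroup A G" "subgroup B G" "B \<subseteq> M"
        and root: "\<And>x k. \<lbrakk>x \<in> M; k \<ge> 1; x [^] (k::nat) \<in> A\<rbrakk> \<Longrightarrow> x \<in> A"
        using A B by (auto simp: isolated_def)
      have "i \<le> n \<Longrightarrow> B \<inter> S i \<subseteq> A" for i
      proof (induction i)
        case 0
        then show ?case using S0 subgroup.one_closed[OF grp(1)] by auto
      next
        case (Suc i)
        then have i: "i < n" "i \<le> n" "B \<inter> S i \<subseteq> A" by auto
        note SS = S[OF Suc.prems] and Si = S[OF i(2)]
        interpret N: normal "S i" "G\<lparr>carrier := S (Suc i)\<rparr>" using S_norm[OF i(1)] .
        have sub: "S i \<subseteq> S (Suc i)" using N.subset by simp
        have "normalises (S (Suc i)) (S i)"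
          using N.inv_op_closed2 SS by (auto simp: normalises_def)
        then interpret quotient_map G "G\<lparr>carrier := S (Suc i)\<rparr> Mod S i" "S (Suc i)" "S i" "\<lambda>x. S i #> x"
          using quotient_map_FactGroup[OF SS Si sub] by simp
        show ?case
        proof
          fix b assume b: "b \<in> B \<inter> S (Suc i)"
          show "b \<in> A"
          proof (cases "\<exists>k::nat. k \<ge> 1 \<and> b [^] k \<in> S i")
            case True
            then obtain k :: nat where k: "k \<ge> 1" "b [^] k \<in> S i" by blast
            then have "b [^] k \<in> A" using i(3) b subgroup_nat_pow_closed[OF grp(2), of b k] by auto
            then show ?thesis using root k b grp by blast
          next
            case False
            then have "i \<in> J B" using b i by (auto simp: J_def)
            then have "i \<in> J A" using JJ by simp
            then obtain a where a: "a \<in> A" "a \<in> S (Suc i)" "\<And>k::nat. k \<ge> 1 \<Longrightarrow> a [^] k \<notin> S i"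
              by (auto simp: J_def)
            have "\<exists>(s::nat) (t::int). s \<ge> 1 \<and> b [^] s \<otimes> a [^] t \<in> S i"
              using b a by (intro power_relation_mod[OF S_fac[OF i(1)]]) auto
            then obtain s :: nat and t :: int where st: "s \<ge> 1" "b [^] s \<otimes> a [^] t \<in> S i" by blast
            have at: "a [^] t \<in> A" using subgroup_int_pow_closed[OF grp(1) a(1)] .
            have bs: "b [^] s \<in> B" using subgroup_nat_pow_closed[OF grp(2)] b by simp
            have "b [^] s \<otimes> a [^] t \<in> A"
              using i(3) st at bs AB grp(2) by (auto intro!: subsetD[OF i(3)] subgroup.m_closed)
            then have "(b [^] s \<otimes> a [^] t) \<otimes> inv (a [^] t) \<in> A"
              using at grp by (simp add: subgroup.m_closed subgroup.m_inv_closed)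
            moreover have "(b [^] s \<otimes> a [^] t) \<otimes> inv (a [^] t) = b [^] s"
              using a b by (simp add: word_simps)
            ultimately show ?thesis using root[of b s] st b grp by auto
          qed
        qed
      qed
      from this[of n] show False using AB grp Sn by auto
    qed
    ultimately show "J A \<subset> J B" by blast
  qed
  then show thesis by (rule that[of "\<lambda>A. card (J A)"])
qed

text \<open>The factors of the upper central series of a torsion-free group are torsion-free: for \<open>x \<in> Z\<^sub>i\<^sub>+\<^sub>2\<close>
  and \<open>x\<^sup>n \<in> Z\<^sub>i\<^sub>+\<^sub>1\<close>, modulo \<open>Z\<^sub>i\<close> the commutator \<open>[x, y]\<close> is central and \<open>[x, y]\<^sup>n = [x\<^sup>n, y] = 1\<close>,
  so \<open>[x, y] \<in> Z\<^sub>i\<close> by induction and \<open>x \<in> Z\<^sub>i\<^sub>+\<^sub>1\<close>. As the series reaches \<open>M\<close>, all its terms are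
  isolated in \<open>M\<close>.\<close>

lemma isolated_upper_central:
  assumes M: "subgroup M G" and tf: "\<And>x n. \<lbrakk>x \<in> M; n \<ge> 1; x [^] (n::nat) = \<one>\<rbrakk> \<Longrightarrow> x = \<one>"
    and nil: "nilpotent_mod M {\<one>}"
  shows "isolated M (upper_central M {\<one>} i)"
proof -
  let ?Z = "upper_central M {\<one>}"
  have triv: "subgroup {\<one>} G" "{\<one>} \<subseteq> M" "normalises M {\<one>}"
    using M by (auto simp: normalises_def triv_subgroup subgroup.mem_carrier subgroup.one_closed)
  have Mc: "M \<subseteq> carrier G" using M by (rule subgroup.subset)
  have Z: "subgroup (?Z i) G" for i using subgroup_upper_central[OF M triv(1,3)] .
  have ZM: "?Z i \<subseteq> M" for i using upper_central_subset[OF triv(2)] .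
  have nZ: "normalises M (?Z i)" for i
    using normalises_upper_central[OF M Mc normalises_self[OF M] triv(3)] .
  have mono: "?Z i \<subseteq> ?Z j" if "i \<le> j" for i j using upper_central_mono[OF M triv that] .
  have step: "\<lbrakk>x \<in> ?Z (Suc i); n \<ge> 1; x [^] n \<in> ?Z i\<rbrakk> \<Longrightarrow> x \<in> ?Z i" for x i and n :: nat
  proof (induction i arbitrary: x)
    case 0
    then show ?case using tf[of x n] by simp
  next
    case (Suc i)
    obtain K :: "'a set monoid" and p where "quotient_map G K M (?Z i) p"
      using obtain_quotient_map[OF M Z ZM nZ] .
    then interpret quotient_map G K M "?Z i" p .
    have xM: "x \<in> M" using Suc.prems by simp
    have "commutator x y \<in> ?Z i" if y: "y \<in> M" for y
    proof (rule Suc.IH)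
      show c: "commutator x y \<in> ?Z (Suc i)" using Suc.prems y by simp
      then have "commutator (commutator x y) x \<in> ?Z i" using xM by simp
      then have "K.commutator (p x) (p y) \<otimes>\<^bsub>K\<^esub> p x = p x \<otimes>\<^bsub>K\<^esub> K.commutator (p x) (p y)"
        using commutator_in_iff[of "commutator x y" x] xM y by simp
      then have "p (commutator x y [^] n) = p (commutator (x [^] n) y)"
        using K.commutator_pow_left[of "p x" "p y" n] xM y by simp
      moreover have "commutator (x [^] n) y \<in> ?Z i" using Suc.prems y by simp
      ultimately show "commutator x y [^] n \<in> ?Z i"
        using xM y p_kernel by (metis H_pow commutator_H)
    qed (rule Suc.prems)
    then show ?case using xM by simp
  qed
  obtain N where N: "M \<subseteq> ?Z N" using nil by (auto simp: nilpotent_mod_def)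
  have "x \<in> ?Z i" if x: "x \<in> M" "n \<ge> 1" "x [^] n \<in> ?Z i" for x and n :: nat
  proof -
    have "x \<in> ?Z (i + d) \<Longrightarrow> x \<in> ?Z i" for d
    proof (induction d)
      case (Suc d)
      have "x [^] n \<in> ?Z (i + d)" using x(3) mono[of i "i + d"] by auto
      then show ?case using Suc step[of x "i + d" n] x(2) by simp
    qed simp
    moreover have "x \<in> ?Z (i + N)" using x(1) N mono[of N "i + N"] by auto
    ultimately show ?thesis by blast
  qed
  then show ?thesis using Z ZM unfolding isolated_def by blast
qed

end

section \<open>Nilpotent supplements\<close>

lemma (in group) subset_product_left:
  assumes "A \<subseteq> carrier G" "\<one> \<in> B"
  shows "A \<subseteq> A <#> B"
proof
  fix a assume a: "a \<in> A"
  then have "a = a \<otimes> \<one>" using assms by auto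
  then show "a \<in> A <#> B" using a assms unfolding set_mult_def by blast
qed

lemma (in group) subset_product_right:
  assumes "B \<subseteq> carrier G" "\<one> \<in> A"
  shows "B \<subseteq> A <#> B"
proof
  fix b assume b: "b \<in> B"
  then have "b = \<one> \<otimes> b" using assms by auto
  then show "b \<in> A <#> B" using b assms unfolding set_mult_def by blast
qed

text \<open>The group \<open>C\<close> acts trivially on \<open>B/A\<close>, so \<open>E\<close> has the same fixed vectors as \<open>P = EC\<close>. This is
  applied to subgroups \<open>E\<close> that supplement \<open>M\<close> in \<open>P\<close>.\<close>

lemma (in group) fixed_point_free_supplement:
  assumes sec: "abelian_section P B A" and fpf: "fixed_point_free P B A"
    and E: "E \<subseteq> P" and C: "C \<subseteq> P" "\<And>b m. \<lbrakk>b \<in> B; m \<in> C\<rbrakk> \<Longrightarrow> commutator b m \<in> A"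
    and cover: "\<And>y. y \<in> P \<Longrightarrow> \<exists>x\<in>E. \<exists>m\<in>C. y = x \<otimes> m"
  shows "fixed_point_free E B A"
  unfolding fixed_point_free_def
proof (intro ballI impI)
  note D = abelian_sectionD[OF sec]
  have Pc: "x \<in> carrier G" if "x \<in> P" for x using that D(1) by (simp add: subgroup.mem_carrier)
  fix b assume b: "b \<in> B" "\<forall>x\<in>E. commutator b x \<in> A"
  have "commutator b y \<in> A" if y: "y \<in> P" for y
  proof -
    obtain x m where xm: "x \<in> E" "m \<in> C" "y = x \<otimes> m" using cover[OF y] by blast
    have P: "b \<in> P" "x \<in> P" "m \<in> P" using b xm E C D by auto
    have "commutator b y = commutator b x \<otimes> (x \<otimes> commutator b m \<otimes> inv x)"
      using xm P Pc by (simp add: commutator_mult_right)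
    then show ?thesis
      using b xm C(2) normalisesD[OF D(7) P(2)] D(3) by (simp add: subgroup.m_closed)
  qed
  then show "b \<in> A" using fpf b by (simp add: fixed_point_free_def)
qed

lemma (in group) nilpotent_mod_product:
  assumes B: "subgroup B G" and L: "subgroup L G" and n: "normalises L B"
    and nil: "nilpotent_mod L {\<one>}"
  shows "nilpotent_mod (B <#> L) B"
proof -
  have S: "subgroup (B <#> L) G" using B L n by (rule subgroup_product)
  have BS: "B \<subseteq> B <#> L"
    using subset_product_left subgroup.subset[OF B] subgroup.one_closed[OF L] .
  have LS: "L \<subseteq> B <#> L"
    using subset_product_right subgroup.subset[OF L] subgroup.one_closed[OF B] .
  have nS: "normalises (B <#> L) B"
    unfolding normalises_def
  proof (intro ballI)
    fix h a assume h: "h \<in> B <#> L" and a: "a \<in> B"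
    obtain b l where bl: "b \<in> B" "l \<in> L" "h = b \<otimes> l" using h by (auto simp: set_mult_def)
    have "h \<otimes> a \<otimes> inv h = b \<otimes> (l \<otimes> a \<otimes> inv l) \<otimes> inv b"
      using bl a B L by (simp add: word_simps subgroup.mem_carrier)
    then show "h \<otimes> a \<otimes> inv h \<in> B"
      using bl a B normalisesD[OF n bl(2) a] by (simp add: subgroup.m_closed subgroup.m_inv_closed)
  qed
  obtain K :: "'a set monoid" and p where "quotient_map G K (B <#> L) B p"
    using obtain_quotient_map[OF S B BS nS] .
  then interpret quotient_map G K "B <#> L" B p .
  show ?thesis
  proof (rule nilpotent_mod_of_supplement[OF L LS _ _ nil])
    fix h assume "h \<in> B <#> L"
    then obtain b l where bl: "b \<in> B" "l \<in> L" "h = b \<otimes> l" by (auto simp: set_mult_def)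
    then have "b \<in> B <#> L" "l \<in> B <#> L" using BS LS by auto
    then have "p h = p l" using bl p_kernel[of b] by simp
    then show "\<exists>t\<in>L. p h = p t" using bl by blast
  qed (use B in \<open>simp add: subgroup.one_closed\<close>)
qed

context finite_rank_divisible
begin

text \<open>Fixed vectors of \<open>P\<close> are factored out of \<open>B/N\<close> repeatedly until none is left; the rank bounds
  the number of steps. The terms are the intersections of \<open>B\<close> with the upper central series of
  \<open>P\<close> modulo \<open>N\<close>, which makes the part removed hypercentral.\<close>

lemma isolated_fixed_point_free_layer:
  assumes P: "subgroup P G" and N: "isolated M N" "normalises P N"
    and B: "isolated M B" "normalises P B" and NB: "N \<subseteq> B" and BP: "B \<subseteq> P"
    and ab: "\<And>u v. \<lbrakk>u \<in> B; v \<in> B\<rbrakk> \<Longrightarrow> commutator u v \<in> N"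
  obtains k where "isolated M (B \<inter> upper_central P N k)"
    "abelian_section P B (B \<inter> upper_central P N k)"
    "fixed_point_free P B (B \<inter> upper_central P N k)"
proof -
  define A where "A k = B \<inter> upper_central P N k" for k
  have Pc: "P \<subseteq> carrier G" using P by (rule subgroup.subset)
  have grp: "subgroup N G" "subgroup B G" "B \<subseteq> M" using N B by (auto simp: isolated_def)
  have NP: "N \<subseteq> P" using NB BP by auto
  note mono = upper_central_mono[OF P grp(1) NP N(2)]
  have sec: "abelian_section P B (A k)" for k
  proof -
    have "subgroup (A k) G"
      unfolding A_def
      using subgroups_Inter_pair[OF grp(2) subgroup_upper_central[OF P grp(1) N(2)]] .
    moreover have "normalises P (A k)"
      using B(2) normalises_upper_central[OF P Pc normalises_self[OF P] N(2)]
      by (auto simp: A_def normalises_def)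
    moreover have "N \<subseteq> A k" using mono[of 0 k] NB by (auto simp: A_def)
    ultimately show ?thesis
      using P grp B(2) BP ab by (auto simp: abelian_section_def A_def)
  qed
  have A_Suc: "A (Suc k) = {b \<in> B. \<forall>y\<in>P. commutator b y \<in> A k}" for k
    using normalises_commutator_left[OF grp(2) B(2) _ Pc] BP by (auto simp: A_def)
  have iso: "isolated M (A k)" for k
  proof (induction k)
    case 0
    have "A 0 = N" using NB by (auto simp: A_def)
    then show ?case using N by simp
  next
    case (Suc k)
    show ?case unfolding A_Suc using isolated_commutators_in[OF sec B(1) Suc, of P] by simp
  qed
  have "rk (A k) \<le> rk B" for k using rk_mono[OF iso B(1)] by (auto simp: A_def)
  then have "\<exists>k. \<forall>j. rk (A j) \<le> rk (A k)"
    using ex_has_greatest_nat[of "\<lambda>_. True" 0 "\<lambda>k. rk (A k)" "Suc (rk B)"]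
    by (simp add: less_Suc_eq_le)
  then obtain k where k: "\<And>j. rk (A j) \<le> rk (A k)" by blast
  have "A k \<subseteq> A (Suc k)" using mono[of k "Suc k"] by (auto simp: A_def)
  then have "A (Suc k) = A k" using rk_less[OF iso iso, of k "Suc k"] k[of "Suc k"] by fastforce
  then have "fixed_point_free P B (A k)" using A_Suc[of k] by (auto simp: fixed_point_free_def)
  then show thesis using that[of k] iso sec by (simp add: A_def)
qed

text \<open>Let \<open>A/N\<close> be the unipotent part of \<open>B/N\<close>. Since \<open>M\<close> acts trivially on \<open>B/N\<close> and \<open>P \<inter> R\<close>
  supplements \<open>M\<close> in \<open>P\<close>, the section \<open>B/A\<close> has no fixed points under \<open>P \<inter> R\<close>, so \<open>P \<inter> R\<close> splits
  uniquely over it, and so does \<open>R\<close>. A complement is nilpotent modulo \<open>A\<close> within \<open>P\<close>, and \<open>A\<close> is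
  hypercentral modulo \<open>N\<close>. To capture \<open>L\<close>, the complement is conjugated so that its intersection
  with \<open>BL\<close> becomes the complement \<open>AL\<close>.\<close>

lemma nilpotent_supplement_step:
  assumes P: "subgroup P G" "normalises (carrier G) P" and MP: "M \<subseteq> P"
    and L: "subgroup L G" "L \<subseteq> P"
      "L = {\<one>} \<or> nilpotent_mod L {\<one>} \<and> (\<forall>y\<in>P. \<exists>l\<in>L. \<exists>m\<in>M. y = l \<otimes> m)"
    and N: "isolated M N" "normalises (carrier G) N"
    and B: "isolated M B" "normalises (carrier G) B" and NB: "N \<subseteq> B"
    and central: "\<And>b m. \<lbrakk>b \<in> B; m \<in> M\<rbrakk> \<Longrightarrow> commutator b m \<in> N"
    and R: "subgroup R G" "L \<subseteq> R" "B \<subseteq> R" "nilpotent_mod (P \<inter> R) B"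
      "\<forall>g\<in>carrier G. \<exists>r\<in>R. \<exists>m\<in>M. g = r \<otimes> m"
  shows "\<exists>R'. subgroup R' G \<and> L \<subseteq> R' \<and> N \<subseteq> R' \<and> nilpotent_mod (P \<inter> R') N \<and>
    (\<forall>g\<in>carrier G. \<exists>r\<in>R'. \<exists>m\<in>M. g = r \<otimes> m)"
proof -
  have grp: "subgroup N G" "subgroup B G" "B \<subseteq> M" using N B by (auto simp: isolated_def)
  have c: "P \<subseteq> carrier G" "R \<subseteq> carrier G" "L \<subseteq> carrier G" "M \<subseteq> carrier G" "B \<subseteq> carrier G"
    using P R L M grp by (auto simp: subgroup.subset)
  have BP: "B \<subseteq> P" using grp MP by auto
  obtain k where k: "isolated M (B \<inter> upper_central P N k)"
    "abelian_section P B (B \<inter> upper_central P N k)"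
    "fixed_point_free P B (B \<inter> upper_central P N k)"
    using isolated_fixed_point_free_layer[OF P(1) N(1) normalises_mono[OF N(2) c(1)] B(1)
        normalises_mono[OF B(2) c(1)] NB BP] central grp(3) by blast
  define A where "A = B \<inter> upper_central P N k"
  note A = k(1)[folded A_def] and secP = k(2)[folded A_def] and fpfP = k(3)[folded A_def]
  note DP = abelian_sectionD[OF secP]
  have NA: "N \<subseteq> A"
    using upper_central_mono[OF P(1) grp(1) _ normalises_mono[OF N(2) c(1)], of 0 k] NB BP
    by (auto simp: A_def)
  have nA: "normalises (carrier G) A"
    using B(2) normalises_upper_central[OF subgroup_self c(1) P(2) N(2)]
    by (auto simp: A_def normalises_def)
  have central': "commutator b m \<in> A" if "b \<in> B" "m \<in> M" for b m using central[OF that] NA by auto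
  have sec: "abelian_section S B A" if "subgroup S G" "B \<subseteq> S" for S
    using that DP nA B(2) subgroup.subset[OF that(1)]
    by (auto simp: abelian_section_def intro: normalises_mono)
  let ?H = "P \<inter> R"
  have H: "subgroup ?H G" using subgroups_Inter_pair[OF P(1) R(1)] .
  have fpfH: "fixed_point_free ?H B A"
  proof (rule fixed_point_free_supplement[OF secP fpfP _ MP central'])
    fix y assume y: "y \<in> P"
    then obtain r m where rm: "r \<in> R" "m \<in> M" "y = r \<otimes> m" using R(5) c by blast
    then have "r = y \<otimes> inv m" using c by (simp add: word_simps subset_iff)
    moreover have "y \<otimes> inv m \<in> P"
      using y rm MP P(1) by (auto simp: subgroup.m_closed subgroup.m_inv_closed)
    ultimately have "r \<in> P" by simp
    then show "\<exists>x\<in>?H. \<exists>m\<in>M. y = x \<otimes> m" using rm by blast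
  qed auto
  have splitH: "splits_uniquely ?H B A"
    using splits_uniquely_of_fixed_point_free[OF sec[OF H] B(1) A R(4) fpfH] BP R(3) by blast
  have nH: "normalises R ?H"
    using P(2) normalises_self[OF R(1)] c(2) unfolding normalises_def by blast
  have secR: "abelian_section R B A" using sec[OF R(1,3)] .
  have "splits_uniquely R B A"
    using splits_uniquely_normal_overgroup[OF secR H _ _ nH splitH] BP R(3) by blast
  then obtain T where T: "complement R B A T" by (auto simp: splits_uniquely_def)
  have "\<exists>T'. complement R B A T' \<and> L \<subseteq> T'"
    using L(3)
  proof
    assume "L = {\<one>}"
    then show ?thesis using T complementD(1)[OF T] by (auto simp: subgroup.one_closed)
  next
    assume L': "nilpotent_mod L {\<one>} \<and> (\<forall>y\<in>P. \<exists>l\<in>L. \<exists>m\<in>M. y = l \<otimes> m)"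
    have fpfL: "fixed_point_free L B A"
      using fixed_point_free_supplement[OF secP fpfP L(2) MP central'] L' by blast
    have nLB: "normalises L B" and nLA: "normalises L A"
      using normalises_mono[OF B(2) c(3)] normalises_mono[OF nA c(3)] .
    let ?S = "B <#> L"
    have S: "subgroup ?S G" using grp(2) L(1) nLB by (rule subgroup_product)
    have BS: "B \<subseteq> ?S" using subset_product_left[OF c(5)] L(1) by (simp add: subgroup.one_closed)
    have LS: "L \<subseteq> ?S" using subset_product_right[OF c(3)] grp(2) by (simp add: subgroup.one_closed)
    have SR: "?S \<subseteq> R" using R(2,3) by (auto simp: set_mult_def intro!: subgroup.m_closed[OF R(1)])
    have "fixed_point_free ?S B A" using fpfL LS by (auto simp: fixed_point_free_def)
    then have split: "splits_uniquely ?S B A"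
      using splits_uniquely_of_fixed_point_free[OF sec[OF S BS] B(1) A]
        nilpotent_mod_product[OF grp(2) L(1) nLB] L' by blast
    \<comment> \<open>\<open>L \<inter> B\<close> lies in \<open>A\<close>: iterated commutators with \<open>L\<close> end in \<open>1\<close>, and an element of \<open>B\<close>
      all of whose commutators with \<open>L\<close> lie in \<open>A\<close> lies in \<open>A\<close> itself.\<close>
    have LB: "x \<in> upper_central L {\<one>} i \<Longrightarrow> x \<in> B \<Longrightarrow> x \<in> A" for x i
    proof (induction i arbitrary: x)
      case 0
      then show ?case using DP(3) by (simp add: subgroup.one_closed)
    next
      case (Suc i)
      have "commutator x l \<in> A" if l: "l \<in> L" for l
        using Suc.IH[of "commutator x l"] Suc.prems l
          normalises_commutator_left[OF grp(2) nLB l c(3) Suc.prems(2)] by simp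
      then show ?case using fpfL Suc.prems by (simp add: fixed_point_free_def)
    qed
    have LAL: "L \<subseteq> A <#> L"
      using subset_product_right[OF c(3)] DP(3) by (simp add: subgroup.one_closed)
    have "complement ?S B A (A <#> L)"
      unfolding complement_def
    proof (intro conjI ballI)
      show "subgroup (A <#> L) G" using DP(3) L(1) nLA by (rule subgroup_product)
      show "A \<subseteq> A <#> L"
        using subset_product_left subgroup.subset[OF DP(3)] subgroup.one_closed[OF L(1)] .
      show "A <#> L \<subseteq> ?S" using DP(4) by (auto simp: set_mult_def)
      show "(A <#> L) \<inter> B \<subseteq> A"
      proof
        fix x assume x: "x \<in> (A <#> L) \<inter> B"
        then obtain a l where al: "a \<in> A" "l \<in> L" "x = a \<otimes> l" by (auto simp: set_mult_def)
        have "l = inv a \<otimes> x" using al DP(3) c by (simp add: word_simps subgroup.mem_carrier subset_iff)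
        moreover have "inv a \<otimes> x \<in> B"
          using al x DP(4) grp(2) by (auto simp: subgroup.m_closed subgroup.m_inv_closed)
        ultimately have "l \<in> A" using LB[of l] al L' by (auto simp: nilpotent_mod_def)
        then show "x \<in> A" using al DP(3) by (simp add: subgroup.m_closed)
      qed
      fix h assume "h \<in> ?S"
      then obtain b l where "b \<in> B" "l \<in> L" "h = b \<otimes> l" by (auto simp: set_mult_def)
      then show "\<exists>v\<in>B. \<exists>t\<in>A <#> L. h = v \<otimes> t" using LAL by blast
    qed
    moreover have "complement ?S B A (T \<inter> ?S)" using complement_Int[OF grp(2) DP(4) T S BS SR] .
    ultimately obtain b where b: "b \<in> B" "conjugate b (T \<inter> ?S) = A <#> L"
      using split unfolding splits_uniquely_def by blast
    have bR: "b \<in> R" using b R by auto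
    have "A <#> L \<subseteq> conjugate b T" unfolding b(2)[symmetric] conjugate_def by blast
    with LAL have "L \<subseteq> conjugate b T" by (rule subset_trans)
    moreover have "complement R B A (conjugate b T)"
    proof (rule complement_conjugate[OF secR T])
      have "conjugate b E = E" if "normalises R E" "E \<subseteq> carrier G" for E
        using that normalises_iff_conjugate[OF R(1)] bR by auto
      then show "conjugate b R = R" "conjugate b B = B" "conjugate b A = A"
        using abelian_sectionD[OF secR] normalises_self[OF R(1)] by (simp_all add: subgroup.subset)
    qed (use bR c in auto)
    ultimately show ?thesis by blast
  qed
  then obtain R' where R': "complement R B A R'" and LR': "L \<subseteq> R'" by blast
  note D' = complementD[OF R']
  have "nilpotent_mod (P \<inter> R') N"
  proof (rule nilpotent_mod_trans)
    have sub: "subgroup (P \<inter> R') G" using subgroups_Inter_pair[OF P(1) D'(1)] .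
    have "(P \<inter> R') \<inter> B = A" using D' DP BP by auto
    then show "nilpotent_mod (P \<inter> R') A"
      using nilpotent_mod_restrict[OF sub _ R(4)] D'(3) by auto
    have "(P \<inter> R') \<inter> N = N" using NA D'(2) NB BP by auto
    then show "A \<subseteq> upper_central (P \<inter> R') N k"
      using upper_central_restrict[OF sub, of P N k] D'(2) BP by (auto simp: A_def)
  qed
  moreover have "\<exists>r\<in>R'. \<exists>m\<in>M. g = r \<otimes> m" if g: "g \<in> carrier G" for g
  proof -
    obtain r m where rm: "r \<in> R" "m \<in> M" "g = r \<otimes> m" using R(5) g by blast
    have "inv r \<in> R" using rm R(1) by (simp add: subgroup.m_inv_closed)
    then obtain b t where bt: "b \<in> B" "t \<in> R'" "inv r = b \<otimes> t" using complement_factor[OF R'] by blast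
    have cc: "r \<in> carrier G" "b \<in> carrier G" "t \<in> carrier G" "m \<in> carrier G"
      using rm bt c D'(3) by auto
    have "r = inv (b \<otimes> t)" using cc by (simp flip: bt(3))
    then have "g = inv t \<otimes> (inv b \<otimes> m)" using rm(3) cc by (simp add: word_simps)
    moreover have "inv t \<in> R'" using bt D'(1) by (simp add: subgroup.m_inv_closed)
    moreover have "inv b \<otimes> m \<in> M" using bt rm grp(3) M by (auto simp: subgroup.m_closed subgroup.m_inv_closed)
    ultimately show ?thesis by blast
  qed
  ultimately show ?thesis using D'(1,2) LR' NA by blast
qed

text \<open>Descending induction along the upper central series of \<open>M\<close>, from \<open>R = G\<close> to a subgroup \<open>R\<close> that
  is nilpotent within \<open>P\<close>.\<close>

lemma nilpotent_supplement:
  assumes nM: "normalises (carrier G) M"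
    and tf: "\<And>x n. \<lbrakk>x \<in> M; n \<ge> 1; x [^] (n::nat) = \<one>\<rbrakk> \<Longrightarrow> x = \<one>"
    and nil: "nilpotent_mod M {\<one>}"
    and P: "subgroup P G" "normalises (carrier G) P" and MP: "M \<subseteq> P" and PM: "nilpotent_mod P M"
    and L: "subgroup L G" "L \<subseteq> P"
      "L = {\<one>} \<or> nilpotent_mod L {\<one>} \<and> (\<forall>y\<in>P. \<exists>l\<in>L. \<exists>m\<in>M. y = l \<otimes> m)"
  shows "\<exists>R. subgroup R G \<and> L \<subseteq> R \<and> nilpotent_mod (P \<inter> R) {\<one>} \<and>
    (\<forall>g\<in>carrier G. \<exists>r\<in>R. \<exists>m\<in>M. g = r \<otimes> m)"
proof -
  let ?Z = "upper_central M {\<one>}"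
  have Mc: "M \<subseteq> carrier G" using M by (rule subgroup.subset)
  have triv: "subgroup {\<one>} G" "{\<one>} \<subseteq> M" "normalises M {\<one>}" "normalises (carrier G) {\<one>}"
    using M by (auto simp: normalises_def triv_subgroup subgroup.mem_carrier subgroup.one_closed)
  have iso: "isolated M (?Z i)" for i using isolated_upper_central[OF M tf nil] .
  have norm: "normalises (carrier G) (?Z i)" for i
    using normalises_upper_central[OF subgroup_self Mc nM triv(4)] .
  obtain n where n: "M \<subseteq> ?Z n" using nil by (auto simp: nilpotent_mod_def)
  then have Zn: "?Z n = M" using upper_central_subset[OF triv(2)] by blast
  have "i \<le> n \<Longrightarrow> \<exists>R. subgroup R G \<and> L \<subseteq> R \<and> ?Z (n - i) \<subseteq> R \<and> nilpotent_mod (P \<inter> R) (?Z (n - i)) \<and>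
    (\<forall>g\<in>carrier G. \<exists>r\<in>R. \<exists>m\<in>M. g = r \<otimes> m)" for i
  proof (induction i)
    case 0
    have "P \<inter> carrier G = P" using subgroup.subset[OF P(1)] by auto
    moreover have "\<exists>m\<in>M. g = g \<otimes> m" if "g \<in> carrier G" for g
      using that subgroup.one_closed[OF M] by (intro bexI[of _ \<one>]) auto
    ultimately show ?case
      using PM Zn Mc subgroup.subset[OF L(1)] subgroup_self
      by (intro exI[of _ "carrier G"]) (simp, blast)
  next
    case (Suc i)
    then obtain R where R: "subgroup R G" "L \<subseteq> R" "?Z (n - i) \<subseteq> R"
      "nilpotent_mod (P \<inter> R) (?Z (n - i))" "\<forall>g\<in>carrier G. \<exists>r\<in>R. \<exists>m\<in>M. g = r \<otimes> m" by auto
    have eq: "n - i = Suc (n - Suc i)" using Suc.prems by simp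
    note R = R[unfolded eq]
    show ?case
    proof (rule nilpotent_supplement_step[OF P MP L iso norm iso norm _ _ R])
      show "?Z (n - Suc i) \<subseteq> ?Z (Suc (n - Suc i))" using upper_central_Suc[OF M triv(1-3)] .
    qed simp
  qed
  from this[of n] show ?thesis by simp blast
qed

end

section \<open>The theorem\<close>

lemma (in group) nilpotent_mod_one_of_nilpotent:
  assumes S: "subgroup S G" and nil: "nilpotent (G\<lparr>carrier := S\<rparr>)"
  shows "nilpotent_mod S {\<one>}"
proof -
  interpret S: group "G\<lparr>carrier := S\<rparr>" using S by (rule subgroup_imp_group)
  interpret quotient_map G "G\<lparr>carrier := S\<rparr>" S "{\<one>}" id
    using S by (intro quotient_map.intro quotient_map_axioms.intro) (auto simp: is_group S.is_group)
  show ?thesis using nil by (rule nilpotent_mod_of_nilpotent)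
qed

text \<open>A subgroup of \<open>R\<close> supplements \<open>M\<close> as soon as it maps onto \<open>G/M\<close>, and finitely many elements of
  \<open>R\<close> suffice for that.\<close>

lemma (in group) finitely_generated_supplement:
  assumes R: "subgroup R G" and nM: "M \<lhd> G" and RM: "R <#> M = carrier G"
    and L: "subgroup L G" "L \<subseteq> R"
    and fgL: "finitely_generated (G\<lparr>carrier := L\<rparr>)" and fgQ: "finitely_generated (G Mod M)"
  obtains R' where "subgroup R' G" "L \<subseteq> R'" "R' \<subseteq> R" "R' <#> M = carrier G"
    "finitely_generated (G\<lparr>carrier := R'\<rparr>)"
proof -
  interpret M: normal M G by (rule nM)
  have Rc: "R \<subseteq> carrier G" using R by (rule subgroup.subset)
  have "normalises (carrier G) M" using M.inv_op_closed2 by (auto simp: normalises_def)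
  then interpret quotient_map G "G Mod M" "carrier G" M "\<lambda>x. M #> x"
    using quotient_map_FactGroup[OF subgroup_self M.is_subgroup M.subset] by simp
  obtain S where S: "finite S" "S \<subseteq> L" "generate (G\<lparr>carrier := L\<rparr>) S = L"
    using fgL by (auto simp: finitely_generated_def)
  obtain E where E: "finite E" "E \<subseteq> carrier (G Mod M)" "generate (G Mod M) E = carrier (G Mod M)"
    using fgQ by (auto simp: finitely_generated_def)
  have "\<exists>r\<in>R. M #> r = e" if e: "e \<in> carrier (G Mod M)" for e
  proof -
    obtain g where g: "g \<in> carrier G" "e = M #> g"
      using e by (auto simp: FactGroup_def RCOSETS_def)
    then have "g \<in> R <#> M" using RM by simp
    then obtain r m where rm: "r \<in> R" "m \<in> M" "g = r \<otimes> m" by (auto simp: set_mult_def)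
    then have rc: "r \<in> carrier G" "m \<in> carrier G" using Rc M.subset by auto
    have "g \<otimes> inv r \<in> M" using M.inv_op_closed2[of r m] rm rc by simp
    then have "M #> g = M #> r" using p_eq_iff[OF g(1) rc(1)] by simp
    then show ?thesis using rm g by auto
  qed
  then obtain f where f: "\<And>e. e \<in> carrier (G Mod M) \<Longrightarrow> f e \<in> R \<and> M #> f e = e" by metis
  \<comment> \<open>Lifts of the generators of the quotient are taken in \<open>R\<close>, so the new subgroup stays
    inside \<open>R\<close>.\<close>
  define Y where "Y = f ` E \<union> S"
  have Y: "finite Y" "Y \<subseteq> R" using S E f L by (auto simp: Y_def)
  have Yc: "Y \<subseteq> carrier G" using Y Rc by auto
  let ?R = "generate G Y"
  have R': "subgroup ?R G" using Yc by (rule generate_is_subgroup)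
  have "L \<subseteq> ?R"
    using generate_consistent[OF S(2) L(1)] S(3) mono_generate[of S Y] by (auto simp: Y_def)
  moreover have R'R: "?R \<subseteq> R" using generate_subgroup_incl[OF Y(2) R] .
  moreover have "?R <#> M = carrier G"
  proof
    show "?R <#> M \<subseteq> carrier G"
      using R' M.subset by (auto simp: set_mult_def subgroup.mem_carrier)
    have cosets: "\<exists>r\<in>?R. e = M #> r" if "e \<in> generate (G Mod M) E" for e
      using that
    proof (induction rule: generate.induct)
      case one
      then show ?case using subgroup.one_closed[OF R'] p_one by (metis (lifting))
    next
      case (incl h)
      then have "f h \<in> ?R" "M #> f h = h" using f E by (auto simp: Y_def intro!: generate.incl)
      then show ?case by auto
    next
      case (inv h)
      then have "f h \<in> ?R" "M #> f h = h" using f E by (auto simp: Y_def intro!: generate.incl)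
      then show ?case
        using subgroup.m_inv_closed[OF R'] p_inv[of "f h"] subgroup.mem_carrier[OF R'] by metis
    next
      case (eng h1 h2)
      then obtain r1 r2 where "r1 \<in> ?R" "r2 \<in> ?R" "h1 = M #> r1" "h2 = M #> r2" by blast
      then show ?case
        using subgroup.m_closed[OF R'] p_mult[of r1 r2] subgroup.mem_carrier[OF R'] by metis
    qed
    show "carrier G \<subseteq> ?R <#> M"
    proof
      fix g assume g: "g \<in> carrier G"
      then obtain r where r: "r \<in> ?R" "M #> g = M #> r"
        using cosets p_closed E(3) by metis
      have rc: "r \<in> carrier G" using r R' by (simp add: subgroup.mem_carrier)
      have "g \<otimes> inv r \<in> M" using r(2) p_eq_iff[OF g rc] by simp
      then have "inv r \<otimes> (g \<otimes> inv r) \<otimes> r \<in> M" using M.inv_op_closed1[of r "g \<otimes> inv r"] rc by simp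
      moreover have "g = r \<otimes> (inv r \<otimes> (g \<otimes> inv r) \<otimes> r)" using g rc by (simp add: word_simps)
      ultimately show "g \<in> ?R <#> M" using r unfolding set_mult_def by blast
    qed
  qed
  moreover have "finitely_generated (G\<lparr>carrier := ?R\<rparr>)"
  proof -
    have "Y \<subseteq> ?R" by (auto intro: generate.incl)
    then show ?thesis
      using Y(1) generate_consistent[of Y ?R] R' by (auto simp: finitely_generated_def)
  qed
  ultimately show thesis using that R' by blast
qed

theorem theoremB:
  fixes Q :: "('a, 'b) monoid_scheme" and L M P :: "'a set"
  assumes "group Q"
    and "subgroup L Q" and "subgroup M Q" and "subgroup P Q"
    and "M \<lhd> Q" and "P \<lhd> Q"
    and "L <#>\<^bsub>Q\<^esub> M \<subseteq> P"
    and "nilpotent (Q\<lparr>carrier := M\<rparr>)"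
    and "malcev_complete (Q\<lparr>carrier := M\<rparr>)"
    and "hirsch_length (Q\<lparr>carrier := M\<rparr>) < \<infinity>"
    and "(L = {\<one>\<^bsub>Q\<^esub>} \<and> nilpotent (Q\<lparr>carrier := P\<rparr> Mod M)) \<or>
         (L <#>\<^bsub>Q\<^esub> M = P \<and> nilpotent (Q\<lparr>carrier := L\<rparr>))"
  shows "(\<exists>Q\<^sub>0. subgroup Q\<^sub>0 Q \<and> L \<subseteq> Q\<^sub>0 \<and> nilpotent (Q\<lparr>carrier := P \<inter> Q\<^sub>0\<rparr>) \<and>
                Q\<^sub>0 <#>\<^bsub>Q\<^esub> M = carrier Q) \<and>
         (finitely_generated (Q Mod M) \<and> finitely_generated (Q\<lparr>carrier := L\<rparr>) \<longrightarrow>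
          (\<exists>Q\<^sub>0. subgroup Q\<^sub>0 Q \<and> L \<subseteq> Q\<^sub>0 \<and> nilpotent (Q\<lparr>carrier := P \<inter> Q\<^sub>0\<rparr>) \<and>
                Q\<^sub>0 <#>\<^bsub>Q\<^esub> M = carrier Q \<and> finitely_generated (Q\<lparr>carrier := Q\<^sub>0\<rparr>)))"
proof -
  interpret group Q by fact
  interpret M: normal M Q by fact
  interpret P: normal P Q by fact
  have nM: "normalises (carrier Q) M" using M.inv_op_closed2 by (auto simp: normalises_def)
  have nP: "normalises (carrier Q) P" using P.inv_op_closed2 by (auto simp: normalises_def)
  note L = \<open>subgroup L Q\<close> and M = \<open>subgroup M Q\<close> and P = \<open>subgroup P Q\<close>
  have LM: "L <#>\<^bsub>Q\<^esub> M \<subseteq> P" by fact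
  have MP: "M \<subseteq> P"
    using subset_product_right[OF M.subset subgroup.one_closed[OF L]] LM by blast
  have LP: "L \<subseteq> P"
    using subset_product_left[OF subgroup.subset[OF L] M.one_closed] LM by blast
  have pow: "x [^]\<^bsub>Q\<lparr>carrier := M\<rparr>\<^esub> n = x [^]\<^bsub>Q\<^esub> n" for x and n :: nat
    by (simp flip: nat_pow_consistent)
  have bij: "bij_betw (\<lambda>x. x [^]\<^bsub>Q\<^esub> n) M M" if "n \<ge> 1" for n :: nat
    using \<open>malcev_complete (Q\<lparr>carrier := M\<rparr>)\<close> that by (simp add: malcev_complete_def pow)
  have tf: "x = \<one>\<^bsub>Q\<^esub>" if "x \<in> M" "n \<ge> 1" "x [^]\<^bsub>Q\<^esub> n = \<one>\<^bsub>Q\<^esub>" for x and n :: nat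
    using inj_onD[OF bij_betw_imp_inj_on[OF bij[OF that(2)]], of x "\<one>\<^bsub>Q\<^esub>"] that M.one_closed
    by simp
  have root: "\<exists>y\<in>M. y [^]\<^bsub>Q\<^esub> n = x" if "x \<in> M" "n \<ge> 1" for x and n :: nat
    using bij_betw_imp_surj_on[OF bij[OF that(2)]] that(1) by (metis imageE)
  obtain rk :: "'a set \<Rightarrow> nat"
    where "\<And>A B. \<lbrakk>isolated M A; isolated M B; A \<subset> B\<rbrakk> \<Longrightarrow> rk A < rk B"
    using rank_function_of_finite_hirsch_length[OF M] \<open>hirsch_length (Q\<lparr>carrier := M\<rparr>) < \<infinity>\<close>
    by blast
  then interpret finite_rank_divisible Q M rk using M root by unfold_locales
  have nilM: "nilpotent_mod M {\<one>\<^bsub>Q\<^esub>}"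
    using nilpotent_mod_one_of_nilpotent[OF M] \<open>nilpotent (Q\<lparr>carrier := M\<rparr>)\<close> .
  have L': "L = {\<one>\<^bsub>Q\<^esub>} \<or>
      nilpotent_mod L {\<one>\<^bsub>Q\<^esub>} \<and> (\<forall>y\<in>P. \<exists>l\<in>L. \<exists>m\<in>M. y = l \<otimes>\<^bsub>Q\<^esub> m)"
    and PM: "nilpotent_mod P M"
  proof -
    show "L = {\<one>\<^bsub>Q\<^esub>} \<or>
      nilpotent_mod L {\<one>\<^bsub>Q\<^esub>} \<and> (\<forall>y\<in>P. \<exists>l\<in>L. \<exists>m\<in>M. y = l \<otimes>\<^bsub>Q\<^esub> m)"
      using assms(11) nilpotent_mod_one_of_nilpotent[OF L] by (auto simp: set_mult_def)
    show "nilpotent_mod P M"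
      using assms(11)
    proof (elim disjE conjE)
      assume nil: "nilpotent (Q\<lparr>carrier := P\<rparr> Mod M)"
      interpret quotient_map Q "Q\<lparr>carrier := P\<rparr> Mod M" P M "\<lambda>x. M #>\<^bsub>Q\<^esub> x"
        using quotient_map_FactGroup[OF P M MP normalises_mono[OF nM P.subset]] .
      show ?thesis using nil by (rule nilpotent_mod_of_nilpotent)
    next
      assume "L <#>\<^bsub>Q\<^esub> M = P" and nil: "nilpotent (Q\<lparr>carrier := L\<rparr>)"
      then have "M <#>\<^bsub>Q\<^esub> L = P" using commut_normal[OF L \<open>M \<lhd> Q\<close>] by simp
      then show ?thesis
        using nilpotent_mod_product[OF M L normalises_mono[OF nM subgroup.subset[OF L]]
            nilpotent_mod_one_of_nilpotent[OF L nil]] by simp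
    qed
  qed
  have "\<exists>R. subgroup R Q \<and> L \<subseteq> R \<and> nilpotent_mod (P \<inter> R) {\<one>\<^bsub>Q\<^esub>} \<and>
      (\<forall>g\<in>carrier Q. \<exists>r\<in>R. \<exists>m\<in>M. g = r \<otimes>\<^bsub>Q\<^esub> m)"
    by (rule nilpotent_supplement[OF nM _ nilM P nP MP PM L LP L']) (rule tf)
  then obtain R where R: "subgroup R Q" "L \<subseteq> R" "nilpotent_mod (P \<inter> R) {\<one>\<^bsub>Q\<^esub>}"
    and cover: "\<forall>g\<in>carrier Q. \<exists>r\<in>R. \<exists>m\<in>M. g = r \<otimes>\<^bsub>Q\<^esub> m" by blast
  have RM: "R <#>\<^bsub>Q\<^esub> M = carrier Q"
    using cover subgroup.subset[OF R(1)] M.subset by (fastforce simp: set_mult_def)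
  have nil: "nilpotent (Q\<lparr>carrier := P \<inter> T\<rparr>)" if T: "subgroup T Q" "T \<subseteq> R" for T
  proof -
    have PT: "subgroup (P \<inter> T) Q" using subgroups_Inter_pair[OF P T(1)] .
    have "P \<inter> T \<subseteq> P \<inter> R" using T(2) by auto
    moreover have "(P \<inter> T) \<inter> {\<one>\<^bsub>Q\<^esub>} = {\<one>\<^bsub>Q\<^esub>}" using subgroup.one_closed[OF PT] by auto
    ultimately have "nilpotent_mod (P \<inter> T) {\<one>\<^bsub>Q\<^esub>}"
      using nilpotent_mod_restrict[OF PT _ R(3)] by metis
    then show ?thesis using nilpotent_mod_imp_nilpotent[OF PT] by blast
  qed
  show ?thesis
  proof (intro conjI impI)
    show "\<exists>Q\<^sub>0. subgroup Q\<^sub>0 Q \<and> L \<subseteq> Q\<^sub>0 \<and> nilpotent (Q\<lparr>carrier := P \<inter> Q\<^sub>0\<rparr>) \<and>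
        Q\<^sub>0 <#>\<^bsub>Q\<^esub> M = carrier Q"
      using R nil RM by blast
    assume fg: "finitely_generated (Q Mod M) \<and> finitely_generated (Q\<lparr>carrier := L\<rparr>)"
    obtain T where "subgroup T Q" "L \<subseteq> T" "T \<subseteq> R" "T <#>\<^bsub>Q\<^esub> M = carrier Q"
      "finitely_generated (Q\<lparr>carrier := T\<rparr>)"
      using finitely_generated_supplement[OF R(1) \<open>M \<lhd> Q\<close> RM L R(2)] fg by blast
    then show "\<exists>Q\<^sub>0. subgroup Q\<^sub>0 Q \<and> L \<subseteq> Q\<^sub>0 \<and> nilpotent (Q\<lparr>carrier := P \<inter> Q\<^sub>0\<rparr>) \<and>
        Q\<^sub>0 <#>\<^bsub>Q\<^esub> M = carrier Q \<and> finitely_generated (Q\<lparr>carrier := Q\<^sub>0\<rparr>)"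
      using nil by blast
  qed
qed

end
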